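(* There exists an absolute constant $C>0$ such that the following holds. Let $\mathcal D$ be any distribution on $[0,1]\times\{0,1\}$, let $T\ge 2$, and let $S$ be the uniform distribution over $T$ data points $(p_1,y_1),\ldots,(p_T,y_T)$ drawn i.i.d. from $\mathcal D$. Then $$\mathbb E\,|\mathsf{SCDL}(S)-\mathsf{SCDL}(\mathcal D)|\le C\,T^{-1/2}\log^{3/2}T .$$ Moreover, if $\mathsf{SCDL}(\mathcal D)=0$, then $\mathbb E[\mathsf{SCDL}(S)]\le C\,T^{-1/2}\log T$.
   Context: For $x\in\mathbb R$ write $x_+=\max\{x,0\}$. Let $\mathcal D$ be a probability distribution of pairs $(p,y)\in[0,1]\times\{0,1\}$. For a positive integer $m$ and $i\in\{0,\ldots,m\}$ let $w_i(p)=(1-|mp-i|)_+$, $\pi_i=\mathbb E_{(p,y)\sim\mathcal D}[w_i(p)]$ and $q_i=\mathbb E_{(p,y)\sim\mathcal D}[w_i(p)y]/\pi_i$. Equivalently, $p$ is randomly rounded to $p'\in\{0,1/m,\ldots,1\}$ with $\Pr[p'=i/m\mid p]=w_i(p)$ (rounding to one of the two nearest multiples of $1/m$ so that $\mathbb E[p'\mid p]=p$), and $\pi_i=\Pr[p'=i/m]$, $q_i=\mathbb E[y\mid p'=i/m]$; terms with $\pi_i=0$ are taken to be $0$. Define $$\mathsf{SCDL}_m(\mathcal D)=\max_{i=0,\ldots,m}\Big(\sum_{j=0}^{i}\pi_j\big(q_j-\tfrac{i+1}{m}\big)_+ +\sum_{j=i+1}^{m}\pi_j\big(\tfrac im-q_j\big)_+\Big),$$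 and $\mathsf{SCDL}(\mathcal D)=\inf_{m\in\{2^1,2^2,\ldots\}}\max\{\mathsf{SCDL}_m(\mathcal D),1/m\}$. Expectations are over the random sample. *)

theory Defs
  imports "HOL-Probability.Probability"
begin

text \<open>Weight of rounding p to grid point i/m: w_i(p) = (1 - |m p - i|)_+.\<close>
definition rw :: "nat \<Rightarrow> nat \<Rightarrow> real \<Rightarrow> real" where
  "rw m i p = max (1 - \<bar>real m * p - real i\<bar>) 0"

definition cpi :: "(real \<times> bool) measure \<Rightarrow> nat \<Rightarrow> nat \<Rightarrow> real" where
  "cpi M m i = (\<integral>z. rw m i (fst z) \<partial>M)"

text \<open>q_i = E[w_i(p) y] / pi_i (division by 0 yields 0).\<close>
definition cq :: "(real \<times> bool) measure \<Rightarrow> nat \<Rightarrow> nat \<Rightarrow> real" where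
  "cq M m i = (\<integral>z. rw m i (fst z) * (if snd z then 1 else 0) \<partial>M) / cpi M m i"

definition SCDL_m :: "(real \<times> bool) measure \<Rightarrow> nat \<Rightarrow> real" where
  "SCDL_m M m = Max ((\<lambda>i.
      (\<Sum>j\<in>{0..i}. cpi M m j * max (cq M m j - real (i+1) / real m) 0)
    + (\<Sum>j\<in>{i+1..m}. cpi M m j * max (real i / real m - cq M m j) 0)) ` {0..m})"

definition SCDL :: "(real \<times> bool) measure \<Rightarrow> real" where
  "SCDL M = (INF k\<in>{1::nat..}. max (SCDL_m M (2^k)) (1 / 2^k))"

definition empirical :: "nat \<Rightarrow> (nat \<Rightarrow> real \<times> bool) \<Rightarrow> (real \<times> bool) measure" where
  "empirical T xs = measure_pmf (map_pmf xs (pmf_of_set {..<T}))"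

end

theory Submission
  imports Defs
begin

text \<open>
  Write \<open>a j = E[w_j y]\<close> and \<open>p j = E[w_j]\<close>, so that \<open>SCDL_m\<close> is a maximum over thresholds of sums
  of positive parts \<open>(a j - v * p j)_+\<close> and of their mirror images under \<open>(p, y) \<mapsto> (1 - p, 1 - y)\<close>.

  By Bernstein's inequality all empirical \<open>a j\<close> and \<open>p j\<close> at all scales \<open>m = 2^k \<le> 4 sqrt T / ln T\<close> are
  within \<open>sqrt (p j * d) + d\<close>, \<open>d ~ ln T / T\<close>, of the true ones. Summing this error over \<open>j\<close> would
  lose a factor \<open>sqrt m\<close>. However, at distance \<open>l = i - j\<close> from the threshold the error matters only if
  it is comparable to \<open>p j * l / m\<close>, which costs \<open>m * d / l\<close>, or if bin \<open>j\<close> is miscalibrated by order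
  \<open>l / m\<close>; the miscalibrated mass is controlled by the terms of \<open>SCDL_m\<close> at lower thresholds, and
  Cauchy--Schwarz gives a total error of order
  \<open>m * d * ln m + ln m * sqrt (m * SCDL_m * d)\<close>.

  Averaging two adjacent thresholds shows that \<open>SCDL_m \<le> SCDL_{2m}\<close>. Hence the infimum defining
  \<open>SCDL\<close> is attained, up to \<open>ln T / sqrt T\<close>, at a scale \<open>m \<le> 4 sqrt T / ln T\<close> with \<open>m * SCDL_m \<le> 2\<close>.
\<close>

section \<open>Perturbation of one-sided threshold sums\<close>

definition over :: "nat \<Rightarrow> (nat \<Rightarrow> real) \<Rightarrow> (nat \<Rightarrow> real) \<Rightarrow> nat \<Rightarrow> real" where
  "over m a p i = (\<Sum>j\<le>i. max (a j - real (i + 1) / real m * p j) 0)"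

lemma over_nonneg: "0 \<le> over m a p i"
  unfolding over_def by (intro sum_nonneg) auto

lemma harm_reversed: "(\<Sum>j<i. 1 / real (i - j)) = (harm i :: real)"
proof -
  have "(\<Sum>j<i. 1 / real (i - j)) = (\<Sum>h\<in>{1..i}. 1 / real h)"
    by (rule sum.reindex_bij_witness[where i = "\<lambda>h. i - h" and j = "\<lambda>j. i - j"]) auto
  then show ?thesis by (simp add: harm_def divide_inverse)
qed

text \<open>At least \<open>l / 2\<close> integers lie in \<open>[l / 2, l]\<close>, and each
  contributes at least \<open>1 / l\<close>. So the weights \<open>1 / h\<close> guarantee every
  distance \<open>l\<close> the same share, whatever its size.\<close>

lemma half_harmonic_block:
  assumes "l > (0::nat)"
  shows "1 / 2 \<le> (\<Sum>h\<in>{h. l \<le> 2 * h \<and> h \<le> l}. 1 / real h)"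
proof -
  let ?A = "{h. l \<le> 2 * h \<and> h \<le> l}"
  have A: "?A = {(l + 1) div 2..l}" by auto
  have "real l / 2 \<le> real (card ?A)" unfolding A by auto
  then have "1 / 2 \<le> real (card ?A) * (1 / real l)" using assms by (simp add: field_simps)
  also have "\<dots> \<le> (\<Sum>h\<in>?A. 1 / real h)"
    by (rule sum_bounded_below) (use assms in \<open>auto intro!: divide_left_mono mult_pos_pos\<close>)
  finally show ?thesis .
qed

text \<open>Here \<open>X\<close> stands for \<open>a - v * p\<close> at distance \<open>l\<close>
  below the threshold, and \<open>e = sqrt (p * d) + d\<close>. If \<open>X\<close> lies below
  \<open>- 2 * e\<close>, the perturbed positive part is still zero. Otherwise either
  \<open>e\<close> is at least of order \<open>l * p / m\<close>, which makes \<open>p\<close> so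
  small that \<open>e\<close> is of order \<open>m * d / l\<close>, or \<open>e\<close> is smaller,
  and then \<open>X\<close> cannot drop below \<open>- (l * p / (4 * m))\<close>.\<close>

lemma deviation_trichotomy:
  fixes p d m l X X' :: real
  assumes "0 \<le> p" "0 \<le> d" "0 < l" "l \<le> m"
    and X': "X' \<le> X + 2 * (sqrt (p * d) + d)"
  shows "max X' 0 \<le> max X 0 + 64 * m * d / l
           + (if - (l * p / (4 * m)) \<le> X then 4 * sqrt (p * d) else 0)"
proof -
  define e where "e = sqrt (p * d) + d"
  have m: "0 < m" using assms by simp
  have e0: "0 \<le> e" "0 \<le> sqrt (p * d)" using assms by (auto simp: e_def)
  have t0: "0 \<le> 64 * m * d / l" using assms by auto
  consider "X \<le> - 2 * e" | "X > - 2 * e" "l * p \<le> 8 * m * e" | "X > - 2 * e" "l * p > 8 * m * e"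
    by linarith
  then show ?thesis
  proof cases
    case 1
    then have "X' \<le> 0" using X' by (simp add: e_def)
    moreover have "0 \<le> max X 0" by simp
    ultimately show ?thesis using t0 e0 by auto
  next
    case 2
    have "2 * e \<le> 64 * m * d / l"
    proof (cases "p \<le> d")
      case True
      then have "sqrt (p * d) \<le> sqrt (d * d)" using assms by (intro real_sqrt_le_mono mult_right_mono) auto
      then have "2 * e \<le> 4 * d" using assms by (simp add: e_def)
      also have "\<dots> \<le> 64 * (m / l) * d" using assms by (intro mult_right_mono) (auto simp: field_simps)
      finally show ?thesis by simp
    next
      case False
      \<comment> \<open>In square roots, \<open>e \<le> 2 * (r * s)\<close> turns
        \<open>l * p \<le> 8 * m * e\<close> into \<open>l * r \<le> 16 * m * s\<close>; multiplying
        by \<open>s\<close> bounds \<open>l * e\<close> by a multiple of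
        \<open>m * d\<close>.\<close>
      define r s where "r = sqrt p" "s = sqrt d"
      have rs: "p = r * r" "d = s * s" "0 \<le> s" "s < r"
        using assms False by (auto simp: r_s_def)
      have sq: "sqrt (p * d) = r * s" by (simp add: r_s_def real_sqrt_mult)
      have "s * s \<le> r * s" using rs by (intro mult_right_mono) auto
      then have er: "e \<le> 2 * (r * s)" using rs sq by (simp add: e_def)
      have "8 * m * e \<le> 8 * m * (2 * (r * s))" using er m by (intro mult_left_mono) auto
      then have "l * (r * r) \<le> 8 * m * (2 * (r * s))" using 2(2) unfolding rs(1) by linarith
      then have "r * (l * r) \<le> r * (16 * m * s)" by (simp add: algebra_simps)
      then have "l * r \<le> 16 * m * s" using rs by (simp add: mult_le_cancel_left)
      then have "l * r * s \<le> 16 * m * s * s" using rs by (intro mult_right_mono) auto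
      moreover have "e * l \<le> 2 * (r * s) * l" using er assms by (intro mult_right_mono) auto
      ultimately have "2 * e * l \<le> 64 * m * d" using rs(2) by (simp add: algebra_simps)
      then show ?thesis using assms by (simp add: field_simps)
    qed
    then have "max X' 0 \<le> max X 0 + 64 * m * d / l" using X' t0 by (auto simp: e_def)
    moreover have "0 \<le> (if - (l * p / (4 * m)) \<le> X then 4 * sqrt (p * d) else 0)" using e0 by simp
    ultimately show ?thesis by linarith
  next
    case 3
    \<comment> \<open>Because \<open>l \<le> m\<close>, this case gives \<open>8 * e < p\<close>,
      hence \<open>d \<le> p\<close>, and the additive \<open>d\<close> is absorbed into
      \<open>sqrt (p * d)\<close>.\<close>
    have "l * p \<le> m * p" using assms by (intro mult_right_mono) auto
    then have "8 * m * e < m * p" using 3(2) by linarith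
    then have "8 * e < p" using m by simp
    moreover have "d \<le> e" using e0 by (simp add: e_def)
    ultimately have dp: "d \<le> p" using assms by linarith
    then have "sqrt (d * d) \<le> sqrt (p * d)" using assms by (intro real_sqrt_le_mono mult_right_mono) auto
    then have "2 * e \<le> 4 * sqrt (p * d)" using assms by (simp add: e_def)
    moreover have "- (l * p / (4 * m)) \<le> X" 
    proof -
      have "2 * e \<le> l * p / (4 * m)" using 3(2) m by (simp add: field_simps)
      then show ?thesis using 3(1) by linarith
    qed
    ultimately show ?thesis using X' t0 e0 by (auto simp: e_def)
  qed
qed

text \<open>Each index \<open>j\<close> of \<open>B\<close> also has \<open>a j\<close> exceeding the lower thresholds \<open>(i - h + 1) / m\<close>
  for \<open>(i - j) / 2 \<le> h \<le> i - j\<close>, so it is charged to \<open>over m a p (i - h)\<close>;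
  the weights \<open>1 / h\<close> balance the charges.\<close>
lemma charged_mass_le:
  fixes a p :: "nat \<Rightarrow> real"
  assumes m: "0 < m" and p: "\<And>j. j \<le> i \<Longrightarrow> 0 \<le> p j"
    and over: "\<And>i'. i' \<le> i \<Longrightarrow> over m a p i' \<le> \<epsilon>"
    and B: "B \<subseteq> {..<i}" "\<And>j. j \<in> B \<Longrightarrow> - (real (i - j) * p j / (4 * real m)) \<le> a j - real (i + 1) / real m * p j"
  shows "(\<Sum>j\<in>B. p j * real (i - j)) \<le> 8 * real m * \<epsilon> * harm i"
proof -
  \<comment> \<open>Lowering the threshold by \<open>h \<ge> (i - j) / 2\<close> steps raises the
    excess of bin \<open>j\<close> by at least \<open>2 * c j\<close>, while membership in
    \<open>B\<close> costs at most \<open>c j\<close>; so \<open>c j\<close> remains.\<close>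
  define c where "c = (\<lambda>j. p j * real (i - j) / (4 * real m))"
  have c0: "0 \<le> c j" if "j \<in> B" for j using that B(1) p[of j] by (auto simp: c_def)
  have finB: "finite B" using B(1) finite_subset by blast
  have charge: "(\<Sum>j\<in>B. if i - j \<le> 2 * h \<and> h \<le> i - j then c j else 0) \<le> \<epsilon>"
    if h: "h \<in> {1..i}" for h
  proof -
    have "(\<Sum>j\<in>B. if i - j \<le> 2 * h \<and> h \<le> i - j then c j else 0)
        = (\<Sum>j\<in>{j\<in>B. i - j \<le> 2 * h \<and> h \<le> i - j}. c j)"
      using finB by (simp add: sum.inter_filter)
    also have "\<dots> \<le> (\<Sum>j\<in>{j\<in>B. i - j \<le> 2 * h \<and> h \<le> i - j}. max (a j - real (i - h + 1) / real m * p j) 0)"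
    proof (rule sum_mono)
      fix j assume "j \<in> {j\<in>B. i - j \<le> 2 * h \<and> h \<le> i - j}"
      then have j: "j \<in> B" "i - j \<le> 2 * h" "h \<le> i - j" "j < i" using B(1) by auto
      have "real (i + 1) / real m * p j - real (i - h + 1) / real m * p j = real h / real m * p j"
        using h by (simp add: of_nat_diff diff_divide_distrib[symmetric] left_diff_distrib[symmetric])
      moreover have "real (i - j) / (2 * real m) * p j \<le> real h / real m * p j"
      proof (rule mult_right_mono)
        have "real (i - j) / (2 * real m) \<le> real (2 * h) / (2 * real m)"
          using j(2) by (intro divide_right_mono) (auto simp del: of_nat_diff)
        then show "real (i - j) / (2 * real m) \<le> real h / real m" by simp
      qed (use p[of j] j in auto)
      moreover have "real (i - j) / (2 * real m) * p j = 2 * c j" "real (i - j) * p j / (4 * real m) = c j"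
        by (auto simp: c_def)
      ultimately show "c j \<le> max (a j - real (i - h + 1) / real m * p j) 0"
        using B(2)[OF j(1)] by argo
    qed
    \<comment> \<open>\<open>h \<le> i - j\<close> keeps \<open>j\<close> in the range of summation
      of the lower threshold.\<close>
    also have "\<dots> \<le> over m a p (i - h)"
      unfolding over_def using h B(1) by (intro sum_mono2) fastforce+
    also have "\<dots> \<le> \<epsilon>" using over by simp
    finally show ?thesis .
  qed
  \<comment> \<open>Double counting: every \<open>j\<close> receives total weight at least 1/2 over
    \<open>h\<close>, and after exchanging the sums every \<open>h\<close> collects charge at most
    \<open>\<epsilon>\<close>.\<close>
  have "(\<Sum>j\<in>B. c j * (1 / 2)) \<le> (\<Sum>j\<in>B. c j * (\<Sum>h\<in>{h. i - j \<le> 2 * h \<and> h \<le> i - j}. 1 / real h))"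
    using B(1) c0 by (intro sum_mono mult_left_mono half_harmonic_block) auto
  also have "\<dots> = (\<Sum>j\<in>B. \<Sum>h\<in>{1..i}. (if i - j \<le> 2 * h \<and> h \<le> i - j then c j else 0) * (1 / real h))"
  proof (rule sum.cong[OF refl])
    fix j assume "j \<in> B"
    then have eq: "{h. i - j \<le> 2 * h \<and> h \<le> i - j} = {h\<in>{1..i}. i - j \<le> 2 * h \<and> h \<le> i - j}"
      using B(1) by auto
    show "c j * (\<Sum>h\<in>{h. i - j \<le> 2 * h \<and> h \<le> i - j}. 1 / real h)
        = (\<Sum>h\<in>{1..i}. (if i - j \<le> 2 * h \<and> h \<le> i - j then c j else 0) * (1 / real h))"
      unfolding eq sum.inter_filter[OF finite_atLeastAtMost] sum_distrib_left by (intro sum.cong) auto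
  qed
  also have "\<dots> = (\<Sum>h\<in>{1..i}. (\<Sum>j\<in>B. if i - j \<le> 2 * h \<and> h \<le> i - j then c j else 0) * (1 / real h))"
    unfolding sum_distrib_right by (rule sum.swap)
  also have "\<dots> \<le> (\<Sum>h\<in>{1..i}. \<epsilon> * (1 / real h))"
    using charge by (intro sum_mono mult_right_mono) auto
  also have "\<dots> = \<epsilon> * harm i" by (simp add: harm_def sum_distrib_left divide_inverse)
  finally have "(\<Sum>j\<in>B. c j * (1 / 2)) \<le> \<epsilon> * harm i" .
  moreover have "(\<Sum>j\<in>B. p j * real (i - j)) = 8 * real m * (\<Sum>j\<in>B. c j * (1 / 2))"
    using m by (auto simp: c_def sum_distrib_left intro!: sum.cong)
  ultimately show ?thesis using m by (simp add: mult.assoc)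
qed

lemma threshold_deviation:
  fixes v a a' p p' e :: real
  assumes "0 \<le> v" "v \<le> 1" "\<bar>a' - a\<bar> \<le> e" "\<bar>p' - p\<bar> \<le> e"
  shows "a' - v * p' \<le> a - v * p + 2 * e"
proof -
  have "v * (p - p') \<le> v * e" using assms by (intro mult_left_mono) auto
  also have "\<dots> \<le> 1 * e" using assms by (intro mult_right_mono) auto
  finally have "v * (p - p') \<le> e" by simp
  then show ?thesis using assms(3) by (simp add: right_diff_distrib abs_le_iff)
qed

text \<open>The indices \<open>j < i\<close> are treated by \<open>deviation_trichotomy\<close> with
  \<open>l = i - j\<close>: the costs \<open>m * d / l\<close> add up to a harmonic number, and the
  square-root costs over the nearly violating set \<open>B\<close> are controlled through
  \<open>charged_mass_le\<close>. The hypothesis \<open>i < m\<close> keeps the threshold at most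
  1.\<close>

lemma over_perturb:
  fixes a p a' p' :: "nat \<Rightarrow> real"
  assumes i: "i < m" and d: "0 \<le> d" and p: "\<And>j. j \<le> i \<Longrightarrow> 0 \<le> p j \<and> p j \<le> 1"
    and dev: "\<And>j. j \<le> i \<Longrightarrow> \<bar>a' j - a j\<bar> \<le> sqrt (p j * d) + d"
      "\<And>j. j \<le> i \<Longrightarrow> \<bar>p' j - p j\<bar> \<le> sqrt (p j * d) + d"
    and over: "\<And>i'. i' \<le> i \<Longrightarrow> over m a p i' \<le> \<epsilon>"
  shows "over m a' p' i \<le> over m a p i + 2 * (sqrt d + d) + 64 * real m * d * harm m
           + 4 * harm m * sqrt (8 * real m * \<epsilon> * d)"
proof -
  define X X' where "X = (\<lambda>j. a j - real (i + 1) / real m * p j)"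
    "X' = (\<lambda>j. a' j - real (i + 1) / real m * p' j)"
  define B where "B = {j. j < i \<and> - (real (i - j) * p j / (4 * real m)) \<le> X j}"
  have H: "0 \<le> (harm i::real)" "(harm i::real) \<le> harm m"
    using i by (auto simp: harm_nonneg intro: harm_mono)
  have eps: "0 \<le> \<epsilon>" using over[of i] over_nonneg[of m a p i] by simp
  have XX: "X' j \<le> X j + 2 * (sqrt (p j * d) + d)" if "j \<le> i" for j
  proof -
    have v: "0 \<le> real (i + 1) / real m" "real (i + 1) / real m \<le> 1" using i by auto
    show ?thesis unfolding X_X'_def
      by (rule threshold_deviation[OF v dev(1)[OF that] dev(2)[OF that]])
  qed
  \<comment> \<open>At distance 0 the trichotomy gives nothing, but a single bin can pay the full
    error, with \<open>p i \<le> 1\<close>.\<close>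
  have last: "max (X' i) 0 \<le> max (X i) 0 + 2 * (sqrt d + d)"
  proof -
    have "sqrt (p i * d) \<le> sqrt (1 * d)" using p[of i] d by (intro real_sqrt_le_mono mult_right_mono) auto
    moreover have "0 \<le> sqrt d" using d by simp
    moreover note XX[OF order_refl]
    ultimately have "X' i \<le> X i + 2 * (sqrt d + d)" "0 \<le> 2 * (sqrt d + d)" using d by argo+
    then show ?thesis by auto
  qed
  \<comment> \<open>Cauchy-Schwarz with weights \<open>i - j\<close>: one factor is the charged
    mass, the other a harmonic sum, so nothing is lost by counting bins.\<close>
  have "(\<Sum>j\<in>B. sqrt (p j)) \<le> sqrt (\<Sum>j\<in>B. p j * real (i - j)) * sqrt (\<Sum>j\<in>B. 1 / real (i - j))"
  proof -
    have "(\<Sum>j\<in>B. sqrt (p j)) = (\<Sum>j\<in>B. sqrt (p j * real (i - j)) * sqrt (1 / real (i - j)))"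
      by (rule sum.cong) (auto simp: B_def real_sqrt_mult[symmetric])
    also have "\<dots>\<^sup>2 \<le> (\<Sum>j\<in>B. (sqrt (p j * real (i - j)))\<^sup>2) * (\<Sum>j\<in>B. (sqrt (1 / real (i - j)))\<^sup>2)"
      by (rule Cauchy_Schwarz_ineq_sum)
    also have "\<dots> = (\<Sum>j\<in>B. p j * real (i - j)) * (\<Sum>j\<in>B. 1 / real (i - j))"
      using p by (intro arg_cong2[where f = "(*)"] sum.cong) (auto simp: B_def)
    finally show ?thesis by (simp add: real_le_rsqrt real_sqrt_mult[symmetric])
  qed
  also have "\<dots> \<le> sqrt (8 * real m * \<epsilon> * harm i) * sqrt (harm i)"
  proof (intro mult_mono real_sqrt_le_mono)
    show "(\<Sum>j\<in>B. p j * real (i - j)) \<le> 8 * real m * \<epsilon> * harm i"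
      using i p over by (intro charged_mass_le[where a = a]) (auto simp: B_def X_X'_def)
    have "(\<Sum>j\<in>B. 1 / real (i - j)) \<le> (\<Sum>j<i. 1 / real (i - j))"
      by (intro sum_mono2) (auto simp: B_def)
    then show "(\<Sum>j\<in>B. 1 / real (i - j)) \<le> harm i" by (simp only: harm_reversed)
    have "0 \<le> (\<Sum>j\<in>B. 1 / real (i - j))" by (intro sum_nonneg) auto
    then show "0 \<le> sqrt (\<Sum>j\<in>B. 1 / real (i - j))" by simp
    show "0 \<le> sqrt (8 * real m * \<epsilon> * harm i)" using eps H by simp
  qed
  also have "\<dots> = sqrt (8 * real m * \<epsilon>) * harm i"
    using H by (simp add: real_sqrt_mult)
  also have "\<dots> \<le> sqrt (8 * real m * \<epsilon>) * harm m"
    using H eps by (intro mult_left_mono) auto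
  finally have sqB: "(\<Sum>j\<in>B. sqrt (p j)) \<le> sqrt (8 * real m * \<epsilon>) * harm m" .
  have "(\<Sum>j<i. if - (real (i - j) * p j / (4 * real m)) \<le> X j then 4 * sqrt (p j * d) else 0)
      = (\<Sum>j\<in>B. 4 * sqrt (p j * d))"
    unfolding B_def by (subst sum.inter_filter[symmetric]) (auto intro!: sum.cong)
  also have "\<dots> = 4 * (\<Sum>j\<in>B. sqrt (p j)) * sqrt d"
    by (simp add: real_sqrt_mult sum_distrib_left sum_distrib_right mult.assoc)
  also have "\<dots> \<le> 4 * (sqrt (8 * real m * \<epsilon>) * harm m) * sqrt d"
    using sqB d by (intro mult_right_mono mult_left_mono) auto
  also have "\<dots> = 4 * harm m * sqrt (8 * real m * \<epsilon> * d)" by (simp add: real_sqrt_mult)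
  finally have sB: "(\<Sum>j<i. if - (real (i - j) * p j / (4 * real m)) \<le> X j then 4 * sqrt (p j * d) else 0)
      \<le> 4 * harm m * sqrt (8 * real m * \<epsilon> * d)" .
  have "(\<Sum>j<i. 64 * real m * d / real (i - j)) = 64 * real m * d * harm i"
    unfolding harm_reversed[symmetric] by (simp only: sum_distrib_left times_divide_eq_right mult_1_right)
  also have "\<dots> \<le> 64 * real m * d * harm m" using H d by (intro mult_left_mono) auto
  finally have sH: "(\<Sum>j<i. 64 * real m * d / real (i - j)) \<le> 64 * real m * d * harm m" .
  have "over m a' p' i = (\<Sum>j<i. max (X' j) 0) + max (X' i) 0"
    unfolding over_def X_X'_def lessThan_Suc_atMost[symmetric] by simp
  also have "(\<Sum>j<i. max (X' j) 0) \<le> (\<Sum>j<i. max (X j) 0 + 64 * real m * d / real (i - j)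
      + (if - (real (i - j) * p j / (4 * real m)) \<le> X j then 4 * sqrt (p j * d) else 0))"
    using i d p XX by (intro sum_mono deviation_trichotomy) auto
  also have "\<dots> \<le> (\<Sum>j<i. max (X j) 0) + 64 * real m * d * harm m + 4 * harm m * sqrt (8 * real m * \<epsilon> * d)"
    using sB sH by (simp add: sum.distrib)
  also note last
  also have "(\<Sum>j<i. max (X j) 0) + 64 * real m * d * harm m + 4 * harm m * sqrt (8 * real m * \<epsilon> * d)
      + (max (X i) 0 + 2 * (sqrt d + d)) = over m a p i + 2 * (sqrt d + d) + 64 * real m * d * harm m
           + 4 * harm m * sqrt (8 * real m * \<epsilon> * d)"
    unfolding over_def X_X'_def lessThan_Suc_atMost[symmetric] by simp
  finally show ?thesis by simp
qed

text \<open>A coarse bin is a fine bin plus half of each neighbour, and the positive part is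
  subadditive. Each odd fine bin is shared by two coarse bins except the outermost,
  \<open>2 * i + 1\<close>, which is only half covered; this produces the average of two fine
  sums.\<close>

lemma over_refine:
  fixes a p A P :: "nat \<Rightarrow> real"
  assumes m: "0 < m" and P: "\<And>l. l \<le> 2 * i + 1 \<Longrightarrow> 0 \<le> P l"
    and a: "\<And>j. j \<le> i \<Longrightarrow> a j = A (2 * j) + A (2 * j + 1) / 2 + (if j = 0 then 0 else A (2 * j - 1) / 2)"
    and p: "\<And>j. j \<le> i \<Longrightarrow> p j = P (2 * j) + P (2 * j + 1) / 2 + (if j = 0 then 0 else P (2 * j - 1) / 2)"
  shows "over m a p i \<le> (over (2 * m) A P (2 * i) + over (2 * m) A P (2 * i + 1)) / 2"
proof -
  define v where "v = real (i + 1) / real m"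
  define Y where "Y = (\<lambda>l. max (A l - v * P l) 0)"
  have split: "(\<Sum>j\<le>n. Y (2 * j) + Y (2 * j + 1) / 2 + (if j = 0 then 0 else Y (2 * j - 1) / 2))
      = (\<Sum>l\<le>2 * n. Y l) + Y (2 * n + 1) / 2" for n
    by (induction n) auto
  have "over m a p i \<le> (\<Sum>j\<le>i. Y (2 * j) + Y (2 * j + 1) / 2 + (if j = 0 then 0 else Y (2 * j - 1) / 2))"
    unfolding over_def v_def[symmetric]
  proof (rule sum_mono)
    fix j assume "j \<in> {..i}"
    then have "a j - v * p j = (A (2 * j) - v * P (2 * j)) + (A (2 * j + 1) - v * P (2 * j + 1)) / 2
        + (if j = 0 then 0 else (A (2 * j - 1) - v * P (2 * j - 1)) / 2)"
      using a[of j] p[of j] by (simp add: algebra_simps diff_divide_distrib)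
    moreover have "max (x + y / 2 + (if j = 0 then 0 else z / 2)) 0
        \<le> max x 0 + max y 0 / 2 + (if j = 0 then 0 else max z 0 / 2)" for x y z :: real
      by (auto simp: max_def)
    ultimately show "max (a j - v * p j) 0
        \<le> Y (2 * j) + Y (2 * j + 1) / 2 + (if j = 0 then 0 else Y (2 * j - 1) / 2)"
      unfolding Y_def by presburger
  qed
  also have "\<dots> = ((\<Sum>l\<le>2 * i. Y l) + (\<Sum>l\<le>2 * i + 1. Y l)) / 2" unfolding split by simp
  also have "(\<Sum>l\<le>2 * i + 1. Y l) = over (2 * m) A P (2 * i + 1)"
  proof -
    have "v = real (2 * i + 1 + 1) / real (2 * m)" using m by (simp add: v_def field_simps)
    then show ?thesis unfolding over_def Y_def by simp
  qed
  \<comment> \<open>The fine threshold with index \<open>2 * i\<close> is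
    \<open>v - 1 / (2 * m)\<close>; lowering the threshold only increases the sum.\<close>
  also have "(\<Sum>l\<le>2 * i. Y l) \<le> over (2 * m) A P (2 * i)"
    unfolding over_def Y_def v_def
  proof (intro sum_mono max.mono diff_left_mono mult_right_mono)
    show "real (2 * i + 1) / real (2 * m) \<le> real (i + 1) / real m"
      using m by (simp add: field_simps)
  qed (use P in auto)
  finally show ?thesis by simp
qed

text \<open>The maximum combines an increasing and a decreasing sequence, so the infimum sits near
  their crossing; \<open>k\<close> is essentially the last scale up to \<open>k0\<close> before it.
  A crossing beyond \<open>k0\<close> costs at most \<open>1 / 2 ^ k0\<close>.\<close>

lemma balanced_scale:
  fixes g :: "nat \<Rightarrow> real"
  assumes mono: "\<And>k. 1 \<le> k \<Longrightarrow> g k \<le> g (Suc k)" and g: "0 \<le> g 1" "g 1 \<le> 1" and k0: "1 \<le> k0"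
  obtains k where "1 \<le> k" "k \<le> k0" "2 ^ k * g k \<le> 2"
    "max (g k) (1 / 2 ^ k) \<le> (INF k\<in>{1..}. max (g k) (1 / 2 ^ k)) + 1 / 2 ^ k0"
proof -
  have mono': "g k \<le> g k'" if "1 \<le> k" "k \<le> k'" for k k'
    using that(2)
  proof (induction rule: dec_induct)
    case (step n)
    then show ?case using mono[of n] that(1) by simp
  qed simp
  \<comment> \<open>The bound 2 makes \<open>k = 1\<close> admissible, since
    \<open>g 1 \<le> 1\<close>, and matches the factor 2 between consecutive scales: failure at
    \<open>Suc k\<close> reads \<open>1 / 2 ^ k < g (Suc k)\<close>.\<close>
  define k where "k = Max {k\<in>{1..k0}. 2 ^ k * g k \<le> 2}"
  have fin: "finite {k\<in>{1..k0}. 2 ^ k * g k \<le> 2}" "{k\<in>{1..k0}. 2 ^ k * g k \<le> 2} \<noteq> {}"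
    using k0 g by auto
  then have k: "k \<in> {1..k0}" "2 ^ k * g k \<le> 2" using Max_in[OF fin] unfolding k_def by auto
  have gk: "g k \<le> 2 / 2 ^ k" using k(2) by (simp add: field_simps)
  have "max (g k) (1 / 2 ^ k) - 1 / 2 ^ k0 \<le> (INF k\<in>{1..}. max (g k) (1 / 2 ^ k))"
  proof (rule cINF_greatest)
    fix k' :: nat assume k': "k' \<in> {1..}"
    have pw: "(1::real) / 2 ^ k \<le> 1 / 2 ^ k'" if "k' \<le> k" using that by (simp add: frac_le power_increasing)
    consider "k' < k" | "k' = k" | "k < k'" "k = k0" | "k < k'" "k < k0" using k by fastforce
    then show "max (g k) (1 / 2 ^ k) - 1 / 2 ^ k0 \<le> max (g k') (1 / 2 ^ k')"
    proof cases
      case 1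
      have "2 / 2 ^ k = (1::real) / 2 ^ (k - 1)" using 1 by (cases k) auto
      also have "\<dots> \<le> 1 / 2 ^ k'" using 1 by (intro frac_le power_increasing) auto
      finally have "g k \<le> 1 / 2 ^ k'" using gk by simp
      moreover have "0 < (1::real) / 2 ^ k0" by simp
      moreover have "(1::real) / 2 ^ k \<le> 1 / 2 ^ k'" using 1 by (intro pw) auto
      ultimately show ?thesis by linarith
    next
      case 2 then show ?thesis by simp
    next
      case 3
      have "0 \<le> g k" using g mono'[of 1 k] k by auto
      moreover have "g k \<le> g k'" using 3 k by (intro mono') auto
      moreover have "max (g k) (1 / 2 ^ k0) - 1 / 2 ^ k0 \<le> g k" using \<open>0 \<le> g k\<close> by (simp add: max_def)
      ultimately show ?thesis using 3(2) by fastforce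
    next
      case 4
      have "\<not> 2 ^ Suc k * g (Suc k) \<le> 2"
      proof
        assume "2 ^ Suc k * g (Suc k) \<le> 2"
        then have "Suc k \<le> k" using 4 fin(1) by (subst (2) k_def) (rule Max_ge, auto)
        then show False by simp
      qed
      then have "1 / 2 ^ k < g (Suc k)" by (simp add: field_simps)
      moreover have "g (Suc k) \<le> g k'" "g k \<le> g k'" using 4 k by (auto intro!: mono')
      moreover have "0 < (1::real) / 2 ^ k0" by simp
      ultimately show ?thesis by linarith
    qed
  qed auto
  then have "max (g k) (1 / 2 ^ k) \<le> (INF k\<in>{1..}. max (g k) (1 / 2 ^ k)) + 1 / 2 ^ k0" by linarith
  then show ?thesis using that k by auto
qed

section \<open>SCDL across scales and under perturbation\<close>

definition ca :: "(real \<times> bool) measure \<Rightarrow> nat \<Rightarrow> nat \<Rightarrow> real" where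
  "ca M m i = (\<integral>z. rw m i (fst z) * (if snd z then 1 else 0) \<partial>M)"

text \<open>
  The second sum of \<open>SCDL_m\<close> at threshold \<open>i < m\<close> becomes a first sum at \<open>m - 1 - i\<close> after the
  reflection \<open>j \<mapsto> m - j\<close>. For \<open>i = m\<close> both sums vanish, and the truncated index would be wrong.
\<close>

definition gap :: "nat \<Rightarrow> (nat \<Rightarrow> real) \<Rightarrow> (nat \<Rightarrow> real) \<Rightarrow> nat \<Rightarrow> real" where
  "gap m a p i = over m a p i + over m (\<lambda>j. p (m - j) - a (m - j)) (\<lambda>j. p (m - j)) (m - 1 - i)"

text \<open>Only the two projections are required to be measurable and the sigma-algebra is left
  open, so that both the given distribution and empirical measures, whose sigma-algebra is discrete,
  are instances.\<close>

locale prediction_space = prob_space M for M :: "(real \<times> bool) measure" +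
  assumes fst_measurable [measurable]: "fst \<in> borel_measurable M"
    and snd_measurable [measurable]: "snd \<in> measurable M (count_space UNIV)"
    and range: "AE z in M. fst z \<in> {0..1}"

section \<open>Triangular rounding weights\<close>

lemma rw_nonneg: "0 \<le> rw m i p" and rw_le_1: "rw m i p \<le> 1"
  by (auto simp: rw_def)

lemma rw_borel_measurable [measurable]: "rw m i \<in> borel_measurable borel"
  unfolding rw_def by measurable

lemma sum_rw_le_1:
  assumes "0 \<le> p"
  shows "(\<Sum>j\<le>n. rw m j p) \<le> 1"
proof -
  \<comment> \<open>Partial sums of the hats form a ramp that falls from 1 to 0 as
    \<open>m * p\<close> runs from \<open>n\<close> to \<open>n + 1\<close>; the induction carries
    this exact form.\<close>
  have "(\<Sum>j\<le>n. rw m j p) = min 1 (max 0 (real n + 1 - real m * p))"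
  proof (induction n)
    case 0
    have "0 \<le> real m * p" using assms by simp
    then show ?case by (auto simp: rw_def)
  next
    case (Suc n)
    have "min 1 (max 0 (t + 1 - x)) + max (1 - \<bar>x - (t + 1)\<bar>) 0 = min 1 (max 0 (t + 2 - x))" for t x :: real
      by (simp add: max_def min_def abs_if)
    from this[of "real n" "real m * p"] show ?case using Suc by (simp add: rw_def add.commute)
  qed
  then show ?thesis by simp
qed

text \<open>The two-scale relation of the linear B-spline.\<close>

lemma hat_refine:
  fixes y :: real
  shows "max (1 - \<bar>y\<bar>) 0
    = max (1 - \<bar>2 * y\<bar>) 0 + max (1 - \<bar>2 * y - 1\<bar>) 0 / 2 + max (1 - \<bar>2 * y + 1\<bar>) 0 / 2"
  by (auto simp: max_def abs_if field_simps)

lemma rw_refine: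
  assumes "0 \<le> p"
  shows "rw m j p = rw (2 * m) (2 * j) p + rw (2 * m) (2 * j + 1) p / 2
    + (if j = 0 then 0 else rw (2 * m) (2 * j - 1) p / 2)"
proof -
  have x: "0 \<le> real m * p" using assms by simp
  show ?thesis
  proof (cases "j = 0")
    \<comment> \<open>The left neighbour would have index -1; its hat vanishes for
      \<open>p \<ge> 0\<close>, whereas the truncated index \<open>2 * j - 1 = 0\<close> would count
      bin 0 again.\<close>
    case True
    then show ?thesis using x unfolding rw_def by (auto simp: max_def abs_if field_simps)
  next
    case False
    have e: "real (2 * m) * p - real (2 * j) = 2 * (real m * p - real j)"
      "real (2 * m) * p - real (2 * j + 1) = 2 * (real m * p - real j) - 1"
      "real (2 * m) * p - real (2 * j - 1) = 2 * (real m * p - real j) + 1"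
      using False by (auto simp: of_nat_diff algebra_simps)
    show ?thesis unfolding rw_def e using False by (simp add: hat_refine[of "real m * p - real j"])
  qed
qed

section \<open>Moments and \<open>SCDL_m\<close> of one distribution\<close>

context prediction_space begin

lemma rw_integrable [simp]:
  "integrable M (\<lambda>z. rw m i (fst z))"
  "integrable M (\<lambda>z. rw m i (fst z) * (if snd z then 1 else 0))"
  by (rule integrable_const_bound[where B = 1]; auto simp: rw_nonneg rw_le_1)+

lemma cpi_nonneg: "0 \<le> cpi M m i"
  unfolding cpi_def by (intro Bochner_Integration.integral_nonneg) (auto simp: rw_nonneg)

lemma ca_nonneg: "0 \<le> ca M m i"
  unfolding ca_def by (intro Bochner_Integration.integral_nonneg) (auto simp: rw_nonneg)

lemma ca_le_cpi: "ca M m i \<le> cpi M m i"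
  unfolding ca_def cpi_def by (intro integral_mono) (auto simp: rw_nonneg)

lemma sum_cpi_le_1: "(\<Sum>j\<le>n. cpi M m j) \<le> 1"
proof -
  have "(\<Sum>j\<le>n. cpi M m j) = (\<integral>z. (\<Sum>j\<le>n. rw m j (fst z)) \<partial>M)"
    unfolding cpi_def by simp
  also have "\<dots> \<le> (\<integral>z. 1 \<partial>M)"
    using range by (intro integral_mono_AE) (auto elim!: eventually_mono intro: sum_rw_le_1)
  finally show ?thesis by (simp add: prob_space)
qed

lemma cpi_le_1: "cpi M m j \<le> 1"
  using sum_cpi_le_1[of m j] cpi_nonneg member_le_sum[of j "{..j}" "cpi M m"] by force

lemma cpi_beyond: "m < i \<Longrightarrow> cpi M m i = 0"
  unfolding cpi_def
proof (rule integral_eq_zero_AE)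
  assume "m < i"
  show "AE z in M. rw m i (fst z) = 0"
    using range
  proof eventually_elim
    case (elim z)
    then have "real m * fst z \<le> real m * 1" by (intro mult_left_mono) auto
    then show ?case using \<open>m < i\<close> by (auto simp: rw_def)
  qed
qed

lemma ca_beyond: "m < i \<Longrightarrow> ca M m i = 0"
  using ca_nonneg[of m i] ca_le_cpi[of m i] cpi_beyond[of m i] by simp

lemma cpi_refine: "cpi M m j = cpi M (2 * m) (2 * j) + cpi M (2 * m) (2 * j + 1) / 2
    + (if j = 0 then 0 else cpi M (2 * m) (2 * j - 1) / 2)"
proof -
  have "cpi M m j = (\<integral>z. rw (2 * m) (2 * j) (fst z) + rw (2 * m) (2 * j + 1) (fst z) / 2
    + (if j = 0 then 0 else rw (2 * m) (2 * j - 1) (fst z) / 2) \<partial>M)"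
    unfolding cpi_def
  proof (intro integral_cong_AE)
    show "AE z in M. rw m j (fst z) = rw (2 * m) (2 * j) (fst z) + rw (2 * m) (2 * j + 1) (fst z) / 2
      + (if j = 0 then 0 else rw (2 * m) (2 * j - 1) (fst z) / 2)"
      using range by eventually_elim (rule rw_refine, simp)
  qed auto
  then show ?thesis by (cases "j = 0") (simp_all add: cpi_def)
qed

lemma ca_refine: "ca M m j = ca M (2 * m) (2 * j) + ca M (2 * m) (2 * j + 1) / 2
    + (if j = 0 then 0 else ca M (2 * m) (2 * j - 1) / 2)"
proof -
  let ?y = "\<lambda>z. if snd z then 1 else 0 :: real"
  have "ca M m j = (\<integral>z. rw (2 * m) (2 * j) (fst z) * ?y z + rw (2 * m) (2 * j + 1) (fst z) * ?y z / 2
    + (if j = 0 then 0 else rw (2 * m) (2 * j - 1) (fst z) * ?y z / 2) \<partial>M)"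
    unfolding ca_def using range
  proof (intro integral_cong_AE)
    show "AE z in M. rw m j (fst z) * ?y z = rw (2 * m) (2 * j) (fst z) * ?y z
      + rw (2 * m) (2 * j + 1) (fst z) * ?y z / 2
      + (if j = 0 then 0 else rw (2 * m) (2 * j - 1) (fst z) * ?y z / 2)"
      using range by eventually_elim (use rw_refine[of _ m j] in auto)
  qed auto
  then show ?thesis by (cases "j = 0") (simp_all add: ca_def)
qed

lemma cpi_times_cq: "cpi M m j * cq M m j = ca M m j"
proof (cases "cpi M m j = 0")
  \<comment> \<open>A bin without mass has \<open>ca M m j = 0\<close> by \<open>ca_le_cpi\<close>,
    so the default quotient is consistent.\<close>
  case True
  then show ?thesis using ca_nonneg[of m j] ca_le_cpi[of m j] by simp
qed (simp add: cq_def ca_def)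

lemma over_last: "0 < m \<Longrightarrow> over m (ca M m) (cpi M m) m = 0"
  unfolding over_def
proof (intro sum.neutral ballI)
  fix j assume m: "0 < m"
  have "1 * cpi M m j \<le> real (m + 1) / real m * cpi M m j"
    using m cpi_nonneg by (intro mult_right_mono) auto
  then show "max (ca M m j - real (m + 1) / real m * cpi M m j) 0 = 0"
    using ca_le_cpi[of m j] by auto
qed

lemma SCDL_m_eq:
  assumes m: "0 < m"
  shows "SCDL_m M m = Max ((\<lambda>i. if i = m then 0 else gap m (ca M m) (cpi M m) i) ` {0..m})"
  unfolding SCDL_m_def
proof (intro arg_cong[where f = Max] image_cong refl)
  fix i assume i: "i \<in> {0..m}"
  have "(\<Sum>j\<in>{0..i}. cpi M m j * max (cq M m j - real (i + 1) / real m) 0) = over m (ca M m) (cpi M m) i"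
    unfolding over_def atMost_atLeast0
    by (intro sum.cong refl)
      (simp add: cpi_nonneg max_mult_distrib_left right_diff_distrib cpi_times_cq mult.commute)
  moreover have "(\<Sum>j\<in>{i + 1..m}. cpi M m j * max (real i / real m - cq M m j) 0)
      = over m (\<lambda>j. cpi M m (m - j) - ca M m (m - j)) (\<lambda>j. cpi M m (m - j)) (m - 1 - i)" if "i < m"
  proof -
    \<comment> \<open>With \<open>v = i / m\<close>,
      \<open>v * p - a = (p - a) - (1 - v) * p\<close>, so the reflected sum has threshold
      \<open>1 - v\<close>, which is index \<open>m - 1 - i\<close> under the shift by one in
      \<open>over\<close>.\<close>
    have c: "real (m - 1 - i + 1) / real m = 1 - real i / real m"
      using m that by (simp add: of_nat_diff field_simps)
    have "(\<Sum>j\<in>{i + 1..m}. cpi M m j * max (real i / real m - cq M m j) 0)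
      = (\<Sum>j\<in>{i + 1..m}. max (real i / real m * cpi M m j - ca M m j) 0)"
      by (intro sum.cong refl)
        (simp add: cpi_nonneg max_mult_distrib_left right_diff_distrib cpi_times_cq mult.commute)
    also have "\<dots> = (\<Sum>j\<le>m - 1 - i. max (real i / real m * cpi M m (m - j) - ca M m (m - j)) 0)"
      using that by (intro sum.reindex_bij_witness[where i = "\<lambda>j. m - j" and j = "\<lambda>j. m - j"]) auto
    also have "\<dots> = over m (\<lambda>j. cpi M m (m - j) - ca M m (m - j)) (\<lambda>j. cpi M m (m - j)) (m - 1 - i)"
      unfolding over_def c by (simp add: algebra_simps)
    finally show ?thesis .
  qed
  ultimately show "(\<Sum>j\<in>{0..i}. cpi M m j * max (cq M m j - real (i + 1) / real m) 0)
      + (\<Sum>j\<in>{i + 1..m}. cpi M m j * max (real i / real m - cq M m j) 0)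
      = (if i = m then 0 else gap m (ca M m) (cpi M m) i)"
    using i over_last[OF m] by (auto simp: gap_def)
qed

lemma gap_le_SCDL_m: "i < m \<Longrightarrow> gap m (ca M m) (cpi M m) i \<le> SCDL_m M m"
  by (subst SCDL_m_eq) (auto intro!: Max_ge image_eqI[where x = i])

lemma SCDL_m_leI:
  assumes "0 < m" "0 \<le> b" "\<And>i. i < m \<Longrightarrow> gap m (ca M m) (cpi M m) i \<le> b"
  shows "SCDL_m M m \<le> b"
  using assms by (subst SCDL_m_eq) auto

lemma SCDL_m_nonneg: "0 < m \<Longrightarrow> 0 \<le> SCDL_m M m"
  by (subst SCDL_m_eq) (auto intro!: Max_ge image_eqI[where x = m])

text \<open>At each threshold a bin enters only one of the two sums and contributes at most its
  mass.\<close>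

lemma SCDL_m_le_1:
  assumes m: "0 < m"
  shows "SCDL_m M m \<le> 1"
proof (rule SCDL_m_leI[OF m])
  fix i assume i: "i < m"
  have "over m (ca M m) (cpi M m) i \<le> (\<Sum>j\<le>i. cpi M m j)"
    unfolding over_def
  proof (rule sum_mono)
    fix j
    have "0 \<le> real (i + 1) / real m * cpi M m j" using cpi_nonneg by simp
    then show "max (ca M m j - real (i + 1) / real m * cpi M m j) 0 \<le> cpi M m j"
      using ca_le_cpi[of m j] cpi_nonneg[of m j] by linarith
  qed
  moreover have "over m (\<lambda>j. cpi M m (m - j) - ca M m (m - j)) (\<lambda>j. cpi M m (m - j)) (m - 1 - i)
      \<le> (\<Sum>j\<le>m - 1 - i. cpi M m (m - j))"
    unfolding over_def
  proof (rule sum_mono)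
    fix j
    have "0 \<le> real (m - 1 - i + 1) / real m * cpi M m (m - j)" using cpi_nonneg by simp
    then show "max (cpi M m (m - j) - ca M m (m - j) - real (m - 1 - i + 1) / real m * cpi M m (m - j)) 0
        \<le> cpi M m (m - j)"
      using ca_nonneg[of m "m - j"] cpi_nonneg[of m "m - j"] by linarith
  qed
  moreover have "(\<Sum>j\<le>m - 1 - i. cpi M m (m - j)) = (\<Sum>j\<in>{i<..m}. cpi M m j)"
    using i by (intro sum.reindex_bij_witness[where i = "\<lambda>j. m - j" and j = "\<lambda>j. m - j"]) auto
  moreover have "(\<Sum>j\<le>i. cpi M m j) + (\<Sum>j\<in>{i<..m}. cpi M m j) = (\<Sum>j\<le>m. cpi M m j)"
    using i by (subst sum.union_disjoint[symmetric]) (auto intro!: sum.cong)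
  ultimately show "gap m (ca M m) (cpi M m) i \<le> 1"
    unfolding gap_def using sum_cpi_le_1[of m m] by linarith
qed simp

text \<open>\<open>over_refine\<close> applies to both halves of \<open>gap\<close>. Under
  reflection \<open>2 * (m - 1 - i)\<close> mirrors \<open>2 * i + 1\<close> and its successor
  mirrors \<open>2 * i\<close>, so the two averages recombine into an average of two fine
  gaps.\<close>

lemma SCDL_m_refine:
  assumes m: "0 < m"
  shows "SCDL_m M m \<le> SCDL_m M (2 * m)"
proof (rule SCDL_m_leI[OF m SCDL_m_nonneg])
  fix i assume i: "i < m"
  let ?r = "\<lambda>m j. cpi M m (m - j) - ca M m (m - j)" and ?q = "\<lambda>m j. cpi M m (m - j)"
  have 1: "over m (ca M m) (cpi M m) i
      \<le> (over (2 * m) (ca M (2 * m)) (cpi M (2 * m)) (2 * i) + over (2 * m) (ca M (2 * m)) (cpi M (2 * m)) (2 * i + 1)) / 2"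
    by (rule over_refine[OF m cpi_nonneg ca_refine cpi_refine])
  have idx: "2 * m - 2 * j = 2 * (m - j)" "2 * m - (2 * j + 1) = 2 * (m - j) - 1"
    "j \<noteq> 0 \<Longrightarrow> 2 * m - (2 * j - 1) = 2 * (m - j) + 1" if "j \<le> m - 1 - i" for j
    using that i by auto
  have "over m (?r m) (?q m) (m - 1 - i)
      \<le> (over (2 * m) (?r (2 * m)) (?q (2 * m)) (2 * (m - 1 - i))
        + over (2 * m) (?r (2 * m)) (?q (2 * m)) (2 * (m - 1 - i) + 1)) / 2"
  proof (rule over_refine[OF m])
    fix j assume j: "j \<le> m - 1 - i"
    \<comment> \<open>The coarse bin \<open>m\<close>, that is \<open>j = 0\<close> after
      reflection, has the right neighbour \<open>2 * m + 1\<close> at the fine scale; it is empty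
      because predictions are at most 1 almost surely.\<close>
    have beyond: "cpi M (2 * m) (2 * m + 1) = 0" "ca M (2 * m) (2 * m + 1) = 0"
      using cpi_beyond[of "2 * m" "2 * m + 1"] ca_beyond[of "2 * m" "2 * m + 1"] by simp_all
    have mj: "m - j \<noteq> 0" using j i by simp
    show q: "?q m j = ?q (2 * m) (2 * j) + ?q (2 * m) (2 * j + 1) / 2
        + (if j = 0 then 0 else ?q (2 * m) (2 * j - 1) / 2)"
      using cpi_refine[of m "m - j"] idx[OF j] mj beyond by (cases "j = 0") auto
    have "ca M m (m - j) = ca M (2 * m) (2 * m - 2 * j) + ca M (2 * m) (2 * m - (2 * j + 1)) / 2
        + (if j = 0 then 0 else ca M (2 * m) (2 * m - (2 * j - 1)) / 2)"
      using ca_refine[of m "m - j"] idx[OF j] mj beyond by (cases "j = 0") auto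
    with q show "?r m j = ?r (2 * m) (2 * j) + ?r (2 * m) (2 * j + 1) / 2
        + (if j = 0 then 0 else ?r (2 * m) (2 * j - 1) / 2)"
      by (auto simp: field_simps)
  qed (rule cpi_nonneg)
  moreover have "2 * (m - 1 - i) = 2 * m - 1 - (2 * i + 1)" "2 * (m - 1 - i) + 1 = 2 * m - 1 - 2 * i"
    using i by auto
  ultimately have "gap m (ca M m) (cpi M m) i \<le> (gap (2 * m) (ca M (2 * m)) (cpi M (2 * m)) (2 * i)
      + gap (2 * m) (ca M (2 * m)) (cpi M (2 * m)) (2 * i + 1)) / 2"
    unfolding gap_def using 1 by simp
  also have "\<dots> \<le> SCDL_m M (2 * m)"
  proof -
    have "gap (2 * m) (ca M (2 * m)) (cpi M (2 * m)) (2 * i) \<le> SCDL_m M (2 * m)"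
      "gap (2 * m) (ca M (2 * m)) (cpi M (2 * m)) (2 * i + 1) \<le> SCDL_m M (2 * m)"
      using i by (intro gap_le_SCDL_m; simp)+
    then show ?thesis by simp
  qed
  finally show "gap m (ca M m) (cpi M m) i \<le> SCDL_m M (2 * m)" .
qed (use m in simp)

lemma SCDL_le: "1 \<le> k \<Longrightarrow> SCDL M \<le> max (SCDL_m M (2 ^ k)) (1 / 2 ^ k)"
  unfolding SCDL_def by (intro cINF_lower bdd_belowI2[where m = 0]) (auto intro: max.coboundedI2)

lemma SCDL_nonneg: "0 \<le> SCDL M"
  unfolding SCDL_def by (intro cINF_greatest) (auto intro: max.coboundedI2)

lemma SCDL_le_1: "SCDL M \<le> 1"
  using SCDL_le[of 1] SCDL_m_le_1[of 2] by simp

text \<open>Scales up to \<open>k\<close> contribute at least \<open>1 / 2 ^ k\<close> through the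
  second entry of the maximum, and finer ones at least \<open>SCDL_m M (2 ^ k)\<close> by
  monotonicity. So a positive value at \<open>k\<close> would keep the infimum positive.\<close>

lemma SCDL_m_zero_of_SCDL_zero:
  assumes "SCDL M = 0" "1 \<le> k"
  shows "SCDL_m M (2 ^ k) = 0"
proof -
  have mono: "SCDL_m M (2 ^ k) \<le> SCDL_m M (2 ^ k')" if "k \<le> k'" for k'
    using that
  proof (induction rule: dec_induct)
    case (step n)
    then show ?case using SCDL_m_refine[of "2 ^ n"] by simp
  qed simp
  have "min (SCDL_m M (2 ^ k)) (1 / 2 ^ k) \<le> SCDL M"
    unfolding SCDL_def
  proof (rule cINF_greatest)
    fix k' :: nat
    have "(1::real) / 2 ^ k \<le> 1 / 2 ^ k'" if "k' \<le> k" using that by (simp add: frac_le power_increasing)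
    then show "min (SCDL_m M (2 ^ k)) (1 / 2 ^ k) \<le> max (SCDL_m M (2 ^ k')) (1 / 2 ^ k')"
      using mono[of k'] by (cases "k' \<le> k") (auto simp: min_def max_def)
  qed simp
  moreover have "0 < (1::real) / 2 ^ k" by simp
  ultimately have "SCDL_m M (2 ^ k) \<le> 0" using assms by linarith
  then show ?thesis using SCDL_m_nonneg[of "2 ^ k"] by simp
qed

end

text \<open>All three errors are measured against \<open>cpi\<close> of the first measure, so the
  relation is not symmetric. The third, for the mass with label 0, serves the reflected
  sums.\<close>

definition moments_close :: "real \<Rightarrow> (real \<times> bool) measure \<Rightarrow> (real \<times> bool) measure \<Rightarrow> nat \<Rightarrow> bool" where
  "moments_close d M N m \<longleftrightarrow> (\<forall>j\<le>m. let e = sqrt (cpi M m j * d) + d in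
     \<bar>cpi N m j - cpi M m j\<bar> \<le> e \<and> \<bar>ca N m j - ca M m j\<bar> \<le> e \<and>
     \<bar>(cpi N m j - ca N m j) - (cpi M m j - ca M m j)\<bar> \<le> e)"

lemma SCDL_m_perturb:
  assumes "prediction_space M" "prediction_space N" and m: "0 < m" and d: "0 \<le> d"
    and close: "moments_close d M N m"
  shows "SCDL_m N m \<le> SCDL_m M m
    + 2 * (2 * (sqrt d + d) + 64 * real m * d * harm m + 4 * harm m * sqrt (8 * real m * SCDL_m M m * d))"
proof -
  define e where "e = 2 * (sqrt d + d) + 64 * real m * d * harm m
    + 4 * harm m * sqrt (8 * real m * SCDL_m M m * d)"
  interpret M: prediction_space M by fact
  interpret N: prediction_space N by fact
  have cl: "\<bar>cpi N m j - cpi M m j\<bar> \<le> sqrt (cpi M m j * d) + d"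
    "\<bar>ca N m j - ca M m j\<bar> \<le> sqrt (cpi M m j * d) + d"
    "\<bar>(cpi N m j - ca N m j) - (cpi M m j - ca M m j)\<bar> \<le> sqrt (cpi M m j * d) + d" if "j \<le> m" for j
    using close that by (auto simp: moments_close_def Let_def)
  have e0: "0 \<le> e" unfolding e_def using d M.SCDL_m_nonneg[OF m] harm_nonneg[of m, where 'a = real] by simp
  show ?thesis unfolding e_def[symmetric]
  proof (rule N.SCDL_m_leI[OF m])
    show "0 \<le> SCDL_m M m + 2 * e" using e0 M.SCDL_m_nonneg[OF m] by (intro add_nonneg_nonneg) auto
    fix i assume i: "i < m"
    let ?r = "\<lambda>M j. cpi M m (m - j) - ca M m (m - j)" and ?q = "\<lambda>M j. cpi M m (m - j)"
    have "over m (ca N m) (cpi N m) i \<le> over m (ca M m) (cpi M m) i + e"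
    proof -
      \<comment> \<open>The other half of the gap is nonnegative, so \<open>SCDL_m M m\<close> can
        serve as \<open>\<epsilon>\<close> at every lower threshold.\<close>
      have "over m (ca M m) (cpi M m) i' \<le> SCDL_m M m" if "i' \<le> i" for i'
        using that i M.gap_le_SCDL_m[of i' m] over_nonneg[of m "?r M" "?q M" "m - 1 - i'"]
        by (simp add: gap_def)
      then have "over m (ca N m) (cpi N m) i \<le> over m (ca M m) (cpi M m) i + 2 * (sqrt d + d)
          + 64 * real m * d * harm m + 4 * harm m * sqrt (8 * real m * SCDL_m M m * d)"
        using i d cl by (intro over_perturb) (auto simp: M.cpi_nonneg M.cpi_le_1)
      then show ?thesis by (simp add: e_def)
    qed
    moreover have "over m (?r N) (?q N) (m - 1 - i) \<le> over m (?r M) (?q M) (m - 1 - i) + e"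
    proof -
      have "over m (?r M) (?q M) i' \<le> SCDL_m M m" if "i' \<le> m - 1 - i" for i'
        using that i M.gap_le_SCDL_m[of "m - 1 - i'" m] over_nonneg[of m "ca M m" "cpi M m" "m - 1 - i'"]
        by (simp add: gap_def)
      then have "over m (?r N) (?q N) (m - 1 - i) \<le> over m (?r M) (?q M) (m - 1 - i) + 2 * (sqrt d + d)
          + 64 * real m * d * harm m + 4 * harm m * sqrt (8 * real m * SCDL_m M m * d)"
        using i d cl by (intro over_perturb) (auto simp: M.cpi_nonneg M.cpi_le_1)
      then show ?thesis by (simp add: e_def)
    qed
    ultimately show "gap m (ca N m) (cpi N m) i \<le> SCDL_m M m + 2 * e"
      using M.gap_le_SCDL_m[OF i] unfolding gap_def by linarith
  qed
qed

text \<open>Only one scale of \<open>N\<close> has to be compared, since \<open>SCDL N\<close> is an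
  infimum. In general it is the balanced scale of \<open>M\<close>, where
  \<open>2 ^ k * SCDL_m M (2 ^ k) \<le> 2\<close> tames the square-root error. If
  \<open>SCDL M = 0\<close>, scale \<open>k0\<close> itself is used: there \<open>SCDL_m M\<close>
  is 0 and the square-root error disappears, which is the source of the better rate.\<close>

lemma SCDL_compare:
  assumes M: "prediction_space M" and N: "prediction_space N" and d: "0 \<le> d" and k0: "1 \<le> k0"
    and close: "\<And>k. 1 \<le> k \<Longrightarrow> k \<le> k0 \<Longrightarrow> moments_close d M N (2 ^ k)"
  shows "SCDL N \<le> SCDL M + 1 / 2 ^ k0
    + 2 * (2 * (sqrt d + d) + 64 * 2 ^ k0 * d * harm (2 ^ k0) + 16 * harm (2 ^ k0) * sqrt d)"
    and "SCDL M = 0 \<Longrightarrow> SCDL N \<le> 1 / 2 ^ k0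
    + 2 * (2 * (sqrt d + d) + 64 * 2 ^ k0 * d * harm (2 ^ k0))"
proof -
  interpret M: prediction_space M by fact
  interpret N: prediction_space N by fact
  obtain k where k: "1 \<le> k" "k \<le> k0" "2 ^ k * SCDL_m M (2 ^ k) \<le> 2"
    "max (SCDL_m M (2 ^ k)) (1 / 2 ^ k) \<le> SCDL M + 1 / 2 ^ k0"
  proof (rule balanced_scale[of "\<lambda>k. SCDL_m M (2 ^ k)" k0])
    show "SCDL_m M (2 ^ k) \<le> SCDL_m M (2 ^ Suc k)" for k
      using M.SCDL_m_refine[of "2 ^ k"] by simp
  qed (use k0 M.SCDL_m_nonneg[of 2] M.SCDL_m_le_1[of 2] in \<open>auto simp: SCDL_def\<close>)
  have H: "0 \<le> (harm (2 ^ k) :: real)" "harm (2 ^ k) \<le> (harm (2 ^ k0) :: real)"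
    using k(2) by (auto intro!: harm_mono harm_nonneg power_increasing)
  have pw: "(2::real) ^ k \<le> 2 ^ k0" using k(2) by simp
  have "sqrt (8 * (2 ^ k) * SCDL_m M (2 ^ k) * d) \<le> sqrt (16 * d)"
    using mult_right_mono[OF k(3) d] by (intro real_sqrt_le_mono) (simp add: mult_ac)
  also have "\<dots> = 4 * sqrt d" by (simp add: real_sqrt_mult)
  finally have s: "4 * harm (2 ^ k) * sqrt (8 * (2 ^ k) * SCDL_m M (2 ^ k) * d) \<le> 16 * harm (2 ^ k0) * sqrt d"
    using mult_mono[OF H(2), of "sqrt (8 * (2 ^ k) * SCDL_m M (2 ^ k) * d)" "4 * sqrt d"]
      H d M.SCDL_m_nonneg[of "2 ^ k"] by (simp add: mult_ac)
  have h: "64 * 2 ^ k * d * harm (2 ^ k) \<le> 64 * 2 ^ k0 * d * harm (2 ^ k0)"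
    using pw H d by (intro mult_mono) auto
  have "SCDL_m N (2 ^ k) \<le> SCDL_m M (2 ^ k)
    + 2 * (2 * (sqrt d + d) + 64 * 2 ^ k * d * harm (2 ^ k) + 4 * harm (2 ^ k) * sqrt (8 * 2 ^ k * SCDL_m M (2 ^ k) * d))"
    using SCDL_m_perturb[OF M N _ d close[OF k(1,2)]] by simp
  also have "\<dots> \<le> SCDL_m M (2 ^ k) + 2 * (2 * (sqrt d + d) + 64 * 2 ^ k0 * d * harm (2 ^ k0) + 16 * harm (2 ^ k0) * sqrt d)"
    using s h by (intro add_left_mono mult_left_mono add_mono) auto
  finally have a: "SCDL_m N (2 ^ k) \<le> SCDL_m M (2 ^ k)
    + 2 * (2 * (sqrt d + d) + 64 * 2 ^ k0 * d * harm (2 ^ k0) + 16 * harm (2 ^ k0) * sqrt d)" .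
  have "0 \<le> 2 * (2 * (sqrt d + d) + 64 * 2 ^ k0 * d * harm (2 ^ k0) + 16 * harm (2 ^ k0) * sqrt d)"
    using d H by simp
  moreover have "y \<le> s + u + e" if "0 \<le> e" "y \<le> max b c" "b \<le> a + e" "max a c \<le> s + u"
    for a b c e s u y :: real
    using that by linarith
  ultimately show "SCDL N \<le> SCDL M + 1 / 2 ^ k0
    + 2 * (2 * (sqrt d + d) + 64 * 2 ^ k0 * d * harm (2 ^ k0) + 16 * harm (2 ^ k0) * sqrt d)"
    using N.SCDL_le[OF k(1)] a k(4) by blast
  assume "SCDL M = 0"
  then have z: "SCDL_m M (2 ^ k0) = 0" using k0 by (rule M.SCDL_m_zero_of_SCDL_zero)
  have "SCDL_m N (2 ^ k0) \<le> 2 * (2 * (sqrt d + d) + 64 * 2 ^ k0 * d * harm (2 ^ k0))"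
    using SCDL_m_perturb[OF M N _ d close[OF k0 order_refl]] by (simp add: z)
  moreover have "0 \<le> 2 * (2 * (sqrt d + d) + 64 * 2 ^ k0 * d * harm (2 ^ k0))"
    using d by (simp add: harm_nonneg)
  moreover have "y \<le> u + e" if "b \<le> e" "0 \<le> e" "0 < u" "y \<le> max b u" for b e u y :: real
    using that by linarith
  ultimately show "SCDL N \<le> 1 / 2 ^ k0 + 2 * (2 * (sqrt d + d) + 64 * 2 ^ k0 * d * harm (2 ^ k0))"
    using N.SCDL_le[OF k0] by (simp only: zero_less_divide_1_iff zero_less_power zero_less_numeral)
qed

section \<open>Concentration of empirical moments\<close>

lemma exp_le_quadratic:
  fixes y :: real
  assumes "\<bar>y\<bar> \<le> 1 / 2"
  shows "exp y \<le> 1 + y + y\<^sup>2"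
proof (cases "0 \<le> y")
  case True
  then show ?thesis using assms by (intro exp_bound) auto
next
  case False
  define x where "x = - y"
  have x: "0 < x" "x \<le> 1 / 2" using False assms by (auto simp: x_def)
  have "1 \<le> 1 + x ^ 3" using x by simp
  also have "\<dots> = (1 + x) * (1 - x + x\<^sup>2)" by (simp add: power2_eq_square power3_eq_cube algebra_simps)
  also have "\<dots> \<le> exp x * (1 - x + x\<^sup>2)" using x by (intro mult_right_mono exp_ge_add_one_self) auto
  finally have "exp (- x) * 1 \<le> exp (- x) * (exp x * (1 - x + x\<^sup>2))" by (intro mult_left_mono) auto
  then show ?thesis by (simp add: mult.assoc[symmetric] exp_add[symmetric] x_def)
qed

text \<open>Since \<open>x\<^sup>2 \<le> x\<close> on the unit interval, the quadratic term becomes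
  linear in \<open>x\<close> and its expectation a multiple of the mean; this yields the radius
  \<open>sqrt (\<mu> * d)\<close> of Bernstein type.\<close>

lemma exp_scaled_le:
  fixes t x :: real
  assumes "\<bar>t\<bar> \<le> 1 / 2" "0 \<le> x" "x \<le> 1"
  shows "exp (t * x) \<le> 1 + (t + t\<^sup>2) * x"
proof -
  have "\<bar>t * x\<bar> \<le> 1 / 2 * 1" unfolding abs_mult using assms by (intro mult_mono) auto
  then have "exp (t * x) \<le> 1 + t * x + (t * x)\<^sup>2" by (intro exp_le_quadratic) simp
  also have "(t * x)\<^sup>2 \<le> t\<^sup>2 * x"
    unfolding power_mult_distrib using assms by (intro mult_left_mono) (auto simp: power2_eq_square mult_left_le)
  finally show ?thesis by (simp add: algebra_simps)
qed

text \<open>For \<open>d \<le> \<mu>\<close> the choice \<open>t = sqrt (d / \<mu>) / 2\<close>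
  maximises the main part \<open>t * sqrt (\<mu> * d) - t\<^sup>2 * \<mu>\<close>; otherwise
  \<open>t\<close> is capped at 1/2, the limit of the quadratic bound on \<open>exp\<close>.\<close>

lemma chernoff_exponent:
  fixes \<mu> d :: real
  assumes "0 \<le> \<mu>" "0 < d"
  obtains t where "0 \<le> t" "t \<le> 1 / 2" "d / 4 \<le> t * (sqrt (\<mu> * d) + d) - t\<^sup>2 * \<mu>"
proof (cases "d \<le> \<mu>")
  case True
  define r s where "r = sqrt \<mu>" "s = sqrt d"
  have rs: "\<mu> = r\<^sup>2" "d = s\<^sup>2" "0 < s" "s \<le> r" "sqrt (\<mu> * d) = r * s"
    using assms True by (auto simp: r_s_def real_sqrt_mult)
  show ?thesis
  proof (rule that[of "s / (2 * r)"])
    show "d / 4 \<le> s / (2 * r) * (sqrt (\<mu> * d) + d) - (s / (2 * r))\<^sup>2 * \<mu>"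
    proof -
      have "s / (2 * r) * (r * s + s\<^sup>2) = s\<^sup>2 / 2 + s ^ 3 / (2 * r)" "(s / (2 * r))\<^sup>2 * r\<^sup>2 = s\<^sup>2 / 4"
        using rs by (auto simp: field_simps power2_eq_square power3_eq_cube)
      moreover have "0 \<le> s ^ 3 / (2 * r)" "0 \<le> s\<^sup>2" using rs by auto
      ultimately show ?thesis unfolding rs(5) unfolding rs(1,2) by linarith
    qed
  qed (use rs in \<open>auto simp: field_simps\<close>)
next
  case False
  have "d / 4 \<le> 1 / 2 * (sqrt (\<mu> * d) + d) - (1 / 2)\<^sup>2 * \<mu>"
  proof -
    have "0 \<le> sqrt (\<mu> * d)" using assms by simp
    moreover have "(1 / 2)\<^sup>2 * \<mu> = \<mu> / 4" by (simp add: power2_eq_square)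
    ultimately show ?thesis using False by argo
  qed
  then show ?thesis by (intro that[of "1 / 2"]) auto
qed

context prob_space begin

text \<open>Markov's inequality for the product of the factors \<open>exp (t * f - c)\<close>, whose
  expectation factors by independence. The sign of \<open>t\<close> is free, so that one statement
  covers both tails.\<close>

lemma chernoff_tail:
  assumes f [measurable]: "f \<in> borel_measurable M" and f01: "\<And>z. 0 \<le> f z" "\<And>z. f z \<le> 1"
    and t: "\<bar>t\<bar> \<le> 1 / 2"
  shows "measure (PiM {..<T} (\<lambda>_. M)) {xs \<in> space (PiM {..<T} (\<lambda>_. M)). real T * c \<le> t * (\<Sum>s<T. f (xs s))}
    \<le> exp (real T * ((t + t\<^sup>2) * expectation f - c))" (is "measure ?P ?A \<le> _")
proof -
  interpret P: product_prob_space "\<lambda>_. M" "{..<T}" ..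
  have intf: "integrable M f" by (rule integrable_const_bound[where B = 1]) (auto simp: f01)
  have le: "exp (t * f z - c) \<le> (1 + (t + t\<^sup>2) * f z) * exp (- c)" for z
    using mult_right_mono[OF exp_scaled_le[OF t f01], of "exp (- c)" z]
    by (simp add: exp_add[symmetric])
  have "(\<integral>\<^sup>+z. ennreal (exp (t * f z - c)) \<partial>M) \<le> (\<integral>\<^sup>+z. ennreal ((1 + (t + t\<^sup>2) * f z) * exp (- c)) \<partial>M)"
    by (intro nn_integral_mono ennreal_leI le)
  also have "\<dots> = ennreal (\<integral>z. (1 + (t + t\<^sup>2) * f z) * exp (- c) \<partial>M)"
    using intf le by (intro nn_integral_eq_integral) (auto intro: order_trans[OF exp_ge_zero])
  also have "(\<integral>z. (1 + (t + t\<^sup>2) * f z) * exp (- c) \<partial>M) = (1 + (t + t\<^sup>2) * expectation f) * exp (- c)"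
    using intf by (simp add: prob_space)
  also have "\<dots> \<le> exp ((t + t\<^sup>2) * expectation f) * exp (- c)"
    by (intro mult_right_mono exp_ge_add_one_self) auto
  also have "\<dots> = exp ((t + t\<^sup>2) * expectation f - c)" by (simp add: exp_add[symmetric])
  finally have one: "(\<integral>\<^sup>+z. ennreal (exp (t * f z - c)) \<partial>M) \<le> ennreal (exp ((t + t\<^sup>2) * expectation f - c))"
    by (simp add: ennreal_leI)
  have A: "?A \<in> sets ?P" by measurable
  have "emeasure ?P ?A = (\<integral>\<^sup>+xs. indicator ?A xs \<partial>?P)" using A by simp
  also have "\<dots> \<le> (\<integral>\<^sup>+xs. (\<Prod>s<T. ennreal (exp (t * f (xs s) - c))) \<partial>?P)"
  proof (intro nn_integral_mono)
    fix xs
    have "(\<Prod>s<T. ennreal (exp (t * f (xs s) - c))) = ennreal (exp (t * (\<Sum>s<T. f (xs s)) - real T * c))"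
      by (simp add: prod_ennreal exp_sum[symmetric] sum_subtractf sum_distrib_left)
    moreover have "1 \<le> exp (t * (\<Sum>s<T. f (xs s)) - real T * c)" if "xs \<in> ?A" using that by simp
    ultimately show "indicator ?A xs \<le> (\<Prod>s<T. ennreal (exp (t * f (xs s) - c)))"
      by (auto simp: indicator_def)
  qed
  also have "\<dots> = (\<Prod>s<T. \<integral>\<^sup>+z. ennreal (exp (t * f z - c)) \<partial>M)"
    by (subst P.product_nn_integral_prod) auto
  also have "\<dots> \<le> (\<Prod>s<T. ennreal (exp ((t + t\<^sup>2) * expectation f - c)))"
    using one by (intro prod_mono_ennreal)
  also have "\<dots> = ennreal (exp (real T * ((t + t\<^sup>2) * expectation f - c)))"
    by (simp add: ennreal_power exp_of_nat_mult)
  finally show ?thesis by (simp add: P.emeasure_eq_measure)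
qed

lemma chernoff_two_sided:
  assumes f [measurable]: "f \<in> borel_measurable M" and f01: "\<And>z. 0 \<le> f z" "\<And>z. f z \<le> 1"
    and d: "0 < d" and T: "0 < T"
  shows "measure (PiM {..<T} (\<lambda>_. M)) {xs \<in> space (PiM {..<T} (\<lambda>_. M)).
      sqrt (expectation f * d) + d < \<bar>(\<Sum>s<T. f (xs s)) / real T - expectation f\<bar>}
    \<le> 2 * exp (- (real T * d / 4))" (is "measure ?P ?A \<le> _")
proof -
  interpret P: product_prob_space "\<lambda>_. M" "{..<T}" ..
  define \<mu> where "\<mu> = expectation f"
  define u where "u = sqrt (\<mu> * d) + d"
  have "0 \<le> \<mu>" unfolding \<mu>_def by (intro Bochner_Integration.integral_nonneg f01)
  then obtain t where t: "0 \<le> t" "t \<le> 1 / 2" "d / 4 \<le> t * u - t\<^sup>2 * \<mu>"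
    unfolding u_def using chernoff_exponent d by metis
  have ex: "real T * (t\<^sup>2 * \<mu> - t * u) \<le> - (real T * d / 4)"
  proof -
    have "real T * (t\<^sup>2 * \<mu> - t * u) \<le> real T * (- (d / 4))" using t by (intro mult_left_mono) auto
    then show ?thesis by simp
  qed
  let ?U = "\<lambda>t c. {xs \<in> space ?P. real T * c \<le> t * (\<Sum>s<T. f (xs s))}"
  have U: "?U t c \<in> sets ?P" for t c by measurable
  have "?A \<subseteq> ?U t (t * (\<mu> + u)) \<union> ?U (- t) (- t * (\<mu> - u))"
  proof
    fix xs assume xs: "xs \<in> ?A"
    then consider "\<mu> + u < (\<Sum>s<T. f (xs s)) / real T" | "(\<Sum>s<T. f (xs s)) / real T < \<mu> - u"
      unfolding u_def \<mu>_def by fastforce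
    then show "xs \<in> ?U t (t * (\<mu> + u)) \<union> ?U (- t) (- t * (\<mu> - u))"
    proof cases
      case 1
      then have "real T * (\<mu> + u) \<le> (\<Sum>s<T. f (xs s))" using T by (simp add: field_simps)
      from mult_left_mono[OF this t(1)] show ?thesis using xs by (simp add: mult.left_commute)
    next
      case 2
      then have "(\<Sum>s<T. f (xs s)) \<le> real T * (\<mu> - u)" using T by (simp add: field_simps)
      from mult_left_mono[OF this t(1)] show ?thesis using xs by (simp add: mult.left_commute)
    qed
  qed
  then have "measure ?P ?A \<le> measure ?P (?U t (t * (\<mu> + u)) \<union> ?U (- t) (- t * (\<mu> - u)))"
    by (intro P.finite_measure_mono) (auto intro: U)
  also have "\<dots> \<le> measure ?P (?U t (t * (\<mu> + u))) + measure ?P (?U (- t) (- t * (\<mu> - u)))"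
    by (intro measure_Un_le U)
  also have "\<dots> \<le> exp (real T * ((t + t\<^sup>2) * \<mu> - t * (\<mu> + u))) + exp (real T * ((- t + (- t)\<^sup>2) * \<mu> - - t * (\<mu> - u)))"
    unfolding \<mu>_def using t by (intro add_mono chernoff_tail f f01) auto
  also have "(t + t\<^sup>2) * \<mu> - t * (\<mu> + u) = t\<^sup>2 * \<mu> - t * u" by (simp add: algebra_simps)
  also have "(- t + (- t)\<^sup>2) * \<mu> - - t * (\<mu> - u) = t\<^sup>2 * \<mu> - t * u" by (simp add: algebra_simps)
  also have "exp (real T * (t\<^sup>2 * \<mu> - t * u)) + exp (real T * (t\<^sup>2 * \<mu> - t * u)) \<le> 2 * exp (- (real T * d / 4))"
    using ex by simp
  finally show ?thesis .
qed

lemma chernoff_uniform: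
  fixes f :: "'i \<Rightarrow> 'a \<Rightarrow> real"
  assumes "finite I" and f [measurable]: "\<And>i. f i \<in> borel_measurable M"
    and f01: "\<And>i z. 0 \<le> f i z" "\<And>i z. f i z \<le> 1" and d: "0 < d" and T: "0 < T"
  obtains Bad where "Bad \<in> sets (PiM {..<T} (\<lambda>_. M))"
    "measure (PiM {..<T} (\<lambda>_. M)) Bad \<le> real (card I) * (2 * exp (- (real T * d / 4)))"
    "\<And>xs i. xs \<in> space (PiM {..<T} (\<lambda>_. M)) - Bad \<Longrightarrow> i \<in> I \<Longrightarrow>
      \<bar>(\<Sum>s<T. f i (xs s)) / real T - expectation (f i)\<bar> \<le> sqrt (expectation (f i) * d) + d"
proof -
  interpret P: product_prob_space "\<lambda>_. M" "{..<T}" ..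
  let ?P = "PiM {..<T} (\<lambda>_. M)"
  let ?A = "\<lambda>i. {xs \<in> space ?P. sqrt (expectation (f i) * d) + d < \<bar>(\<Sum>s<T. f i (xs s)) / real T - expectation (f i)\<bar>}"
  have A: "?A i \<in> sets ?P" for i by measurable
  show ?thesis
  proof (rule that[of "\<Union>i\<in>I. ?A i"])
    show "(\<Union>i\<in>I. ?A i) \<in> sets ?P" using \<open>finite I\<close> A by (intro sets.finite_UN) auto
    have "measure ?P (\<Union>i\<in>I. ?A i) \<le> (\<Sum>i\<in>I. measure ?P (?A i))"
      using \<open>finite I\<close> A by (intro P.finite_measure_subadditive_finite) auto
    also have "\<dots> \<le> (\<Sum>i\<in>I. 2 * exp (- (real T * d / 4)))"
      by (intro sum_mono chernoff_two_sided f f01 d T)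
    finally show "measure ?P (\<Union>i\<in>I. ?A i) \<le> real (card I) * (2 * exp (- (real T * d / 4)))" by simp
  qed (auto simp: not_less)
qed

end

text \<open>Re-expresses the error radius in terms of the other mass \<open>p'\<close>, so that the
  two measures may trade places. By the AM-GM inequality, \<open>p \<le> 2 * p' + 3 * d\<close>. The
  factor 2 on the left pays for errors of differences of two moments.\<close>

lemma deviation_swap:
  fixes p p' d :: real
  assumes "0 \<le> p" "0 \<le> p'" "0 \<le> d" and dev: "\<bar>p' - p\<bar> \<le> sqrt (p * d) + d"
  shows "2 * (sqrt (p * d) + d) \<le> sqrt (p' * (8 * d)) + 8 * d"
proof -
  have sq: "sqrt (p * d) \<le> (p + d) / 2" using arith_geo_mean_sqrt[of p d] assms by simp
  then have "p \<le> 2 * p' + 3 * d" using dev by argo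
  then have "sqrt (p * d) \<le> sqrt ((2 * p' + 3 * d) * d)" using assms by (intro real_sqrt_le_mono mult_right_mono) auto
  also have "\<dots> \<le> sqrt (2 * p' * d) + sqrt (3 * d * d)"
    using sqrt_add_le_add_sqrt[of "2 * p' * d" "3 * d * d"] assms by (simp add: algebra_simps)
  also have "sqrt (3 * d * d) \<le> sqrt ((2 * d)\<^sup>2)" using assms by (intro real_sqrt_le_mono) (simp add: power2_eq_square)
  also have "sqrt ((2 * d)\<^sup>2) = 2 * d" using assms by (intro real_sqrt_unique) auto
  finally have "2 * sqrt (p * d) \<le> 2 * sqrt (2 * p' * d) + 4 * d" by simp
  also have "2 * sqrt (2 * p' * d) = sqrt (2\<^sup>2 * (2 * p' * d))" by (simp only: real_sqrt_mult real_sqrt_power) simp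
  finally show ?thesis using assms by (simp add: mult.commute mult.left_commute)
qed

lemma moments_close_both:
  assumes "prediction_space M" "prediction_space N" and d: "0 \<le> d"
    and p: "\<And>j. j \<le> m \<Longrightarrow> \<bar>cpi N m j - cpi M m j\<bar> \<le> sqrt (cpi M m j * d) + d"
    and a: "\<And>j. j \<le> m \<Longrightarrow> \<bar>ca N m j - ca M m j\<bar> \<le> sqrt (ca M m j * d) + d"
  shows "moments_close (8 * d) M N m" "moments_close (8 * d) N M m"
proof -
  interpret M: prediction_space M by fact
  interpret N: prediction_space N by fact
  \<comment> \<open>The third error is at most the sum of the first two, and
    \<open>ca \<le> cpi\<close> brings both to the same radius.\<close>
  have bound: "\<bar>cpi N m j - cpi M m j\<bar> \<le> e \<and> \<bar>ca N m j - ca M m j\<bar> \<le> e \<and>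
     \<bar>(cpi N m j - ca N m j) - (cpi M m j - ca M m j)\<bar> \<le> e"
    if "j \<le> m" "2 * (sqrt (cpi M m j * d) + d) \<le> e" for j e
  proof -
    have "sqrt (ca M m j * d) \<le> sqrt (cpi M m j * d)"
      using M.ca_le_cpi d by (intro real_sqrt_le_mono mult_right_mono) auto
    moreover have "0 \<le> sqrt (cpi M m j * d)" using M.cpi_nonneg d by simp
    ultimately show ?thesis using p[OF that(1)] a[OF that(1)] that(2) d by argo
  qed
  have "2 * (sqrt (cpi M m j * d) + d) \<le> sqrt (cpi M m j * (8 * d)) + 8 * d" for j
    using M.cpi_nonneg d by (intro deviation_swap) auto
  then show "moments_close (8 * d) M N m" unfolding moments_close_def Let_def using bound by blast
  have "2 * (sqrt (cpi M m j * d) + d) \<le> sqrt (cpi N m j * (8 * d)) + 8 * d" if "j \<le> m" for j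
    using M.cpi_nonneg N.cpi_nonneg d p[OF that] by (intro deviation_swap) auto
  then show "moments_close (8 * d) N M m"
    unfolding moments_close_def Let_def using bound by (fastforce simp: abs_minus_commute)
qed

section \<open>Empirical measures and the expected deviation\<close>

lemma integral_empirical:
  fixes f :: "real \<times> bool \<Rightarrow> real"
  assumes "0 < T"
  shows "(\<integral>z. f z \<partial>empirical T xs) = (\<Sum>s<T. f (xs s)) / real T"
  using assms unfolding empirical_def by (subst integral_map_pmf, subst integral_pmf_of_set) auto

lemma prediction_space_empirical:
  assumes "0 < T" "\<And>s. s < T \<Longrightarrow> fst (xs s) \<in> {0..1}"
  shows "prediction_space (empirical T xs)"
proof -
  have "set_pmf (pmf_of_set {..<T}) = {..<T}" using assms by (intro set_pmf_of_set) auto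
  then show ?thesis
    unfolding empirical_def prediction_space_def prediction_space_axioms_def
    using assms by (auto simp: AE_measure_pmf_iff measure_pmf.prob_space_axioms)
qed

lemma dyadic_scale:
  fixes x :: real
  assumes "1 \<le> x"
  obtains k where "1 \<le> k" "x \<le> 2 ^ k" "2 ^ k \<le> 2 * x"
proof -
  obtain n where "x < 2 ^ n" using real_arch_pow[of 2 x] by auto
  then have ex: "\<exists>n. x < 2 ^ n" ..
  define k where "k = (LEAST n. x < 2 ^ n)"
  have k: "x < 2 ^ k" unfolding k_def using ex by (rule LeastI_ex)
  then have "k \<noteq> 0" using assms by (intro notI) simp
  then obtain n where n: "k = Suc n" by (cases k) auto
  then have "\<not> x < 2 ^ n" unfolding k_def by (intro not_less_Least) simp
  then show ?thesis using that[of k] k n by simp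
qed

lemma harm_le_ln: "0 < n \<Longrightarrow> harm n \<le> 1 + ln (real n)"
proof (induction n rule: nat_induct_non_zero)
  case (Suc n)
  have "inverse (real n + 1) \<le> ln (real n + 1) - ln (real n)"
    using ln_le_minus_one[of "real n / (real n + 1)"] Suc by (simp add: ln_div field_simps)
  then show ?case using Suc by (simp add: harm_Suc add.commute)
qed (simp add: harm_expand)

lemma deviation_event:
  assumes D: "prediction_space D" and d: "0 < d" and T: "0 < T"
  obtains Bad where "Bad \<in> sets (PiM {..<T} (\<lambda>_. D))"
    "measure (PiM {..<T} (\<lambda>_. D)) Bad \<le> 8 * (2 ^ k0)\<^sup>2 * exp (- (real T * d / 4))"
    "\<And>xs k. xs \<in> space (PiM {..<T} (\<lambda>_. D)) - Bad \<Longrightarrow> (\<And>s. s < T \<Longrightarrow> fst (xs s) \<in> {0..1}) \<Longrightarrow>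
      1 \<le> k \<Longrightarrow> k \<le> k0 \<Longrightarrow>
      moments_close (8 * d) D (empirical T xs) (2 ^ k) \<and> moments_close (8 * d) (empirical T xs) D (2 ^ k)"
proof -
  interpret prediction_space D by fact
  \<comment> \<open>All bins of all scales up to \<open>k0\<close>, with and without the label
    factor. Indices up to \<open>2 ^ k0\<close> are taken at every scale to keep the index set a
    product; its size is still at most \<open>4 * (2 ^ k0)\<^sup>2\<close>.\<close>
  define I where "I = {1..k0} \<times> {..2 ^ k0 :: nat} \<times> (UNIV :: bool set)"
  define f where "f = (\<lambda>(k, j, b) z. rw (2 ^ k) j (fst z) * (if b then if snd z then 1 else 0 else 1))"
  have "f i \<in> borel_measurable D" for i
    by (cases i; cases "snd (snd i)") (auto simp: f_def)
  moreover have "0 \<le> f i z" "f i z \<le> 1" for i z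
    by (auto simp: f_def rw_nonneg rw_le_1 split: prod.splits)
  ultimately obtain Bad where Bad: "Bad \<in> sets (PiM {..<T} (\<lambda>_. D))"
    "measure (PiM {..<T} (\<lambda>_. D)) Bad \<le> real (card I) * (2 * exp (- (real T * d / 4)))"
    "\<And>xs i. xs \<in> space (PiM {..<T} (\<lambda>_. D)) - Bad \<Longrightarrow> i \<in> I \<Longrightarrow>
      \<bar>(\<Sum>s<T. f i (xs s)) / real T - expectation (f i)\<bar> \<le> sqrt (expectation (f i) * d) + d"
    using d T by (rule chernoff_uniform[of I f d T, rotated 1]) (auto simp: I_def)
  show ?thesis
  proof (rule that[OF Bad(1)])
    have "real k0 \<le> 2 ^ k0" using of_nat_less_two_power[of k0, where 'a = real] by simp
    then have "real k0 * (2 ^ k0 + 1) \<le> 2 ^ k0 * (2 * 2 ^ k0)" by (intro mult_mono) auto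
    then have "real (card I) \<le> 4 * (2 ^ k0)\<^sup>2"
      unfolding I_def card_cartesian_product by (simp add: power2_eq_square algebra_simps)
    then have "real (card I) * (2 * exp (- (real T * d / 4))) \<le> 4 * (2 ^ k0)\<^sup>2 * (2 * exp (- (real T * d / 4)))"
      by (intro mult_right_mono) auto
    then show "measure (PiM {..<T} (\<lambda>_. D)) Bad \<le> 8 * (2 ^ k0)\<^sup>2 * exp (- (real T * d / 4))"
      using order_trans[OF Bad(2)] by (simp add: mult.assoc)
  next
    fix xs k
    assume xs: "xs \<in> space (PiM {..<T} (\<lambda>_. D)) - Bad" "\<And>s. s < T \<Longrightarrow> fst (xs s) \<in> {0..1}"
      and k: "1 \<le> k" "k \<le> k0"
    have I: "(k, j, b) \<in> I" if "j \<le> 2 ^ k" for j b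
      using k that order_trans[OF that, of "2 ^ k0"] by (auto simp: I_def power_increasing)
    note emp = prediction_space_empirical[OF T xs(2)]
    have e: "cpi D (2 ^ k) j = expectation (f (k, j, False))" "ca D (2 ^ k) j = expectation (f (k, j, True))"
      "cpi (empirical T xs) (2 ^ k) j = (\<Sum>s<T. f (k, j, False) (xs s)) / real T"
      "ca (empirical T xs) (2 ^ k) j = (\<Sum>s<T. f (k, j, True) (xs s)) / real T" for j
      using T by (simp_all add: cpi_def ca_def f_def integral_empirical)
    show "moments_close (8 * d) D (empirical T xs) (2 ^ k) \<and> moments_close (8 * d) (empirical T xs) D (2 ^ k)"
      using d by (intro conjI moments_close_both[OF D emp]) (auto simp only: e intro!: Bad(3)[OF xs(1) I])
  qed
qed

text \<open>If \<open>f\<close> is not integrable, its integral is \<open>0\<close> by convention, so no measurability of \<open>f\<close> is assumed.\<close>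

lemma (in prob_space) integral_le_of_good_event:
  assumes Bad: "Bad \<in> sets M" and "0 \<le> a"
    and good: "AE x in M. x \<notin> Bad \<longrightarrow> f x \<le> a" and le1: "AE x in M. f x \<le> (1::real)"
  shows "(\<integral>x. f x \<partial>M) \<le> a + prob Bad"
proof (cases "integrable M f")
  case True
  have "(\<integral>x. f x \<partial>M) \<le> (\<integral>x. a + indicator Bad x \<partial>M)"
  proof (rule integral_mono_AE)
    show "integrable M (\<lambda>x. a + indicator Bad x)"
      using Bad \<open>0 \<le> a\<close> by (intro integrable_const_bound[where B = "a + 1"]) (auto simp: indicator_def)
    show "AE x in M. f x \<le> a + indicator Bad x"
      using good le1 by eventually_elim (use \<open>0 \<le> a\<close> in \<open>auto simp: indicator_def\<close>)
  qed (fact True)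
  also have "\<dots> = a + prob Bad" using Bad by (subst Bochner_Integration.integral_add) (auto simp: prob_space less_top[symmetric])
  finally show ?thesis .
next
  case False
  then show ?thesis using \<open>0 \<le> a\<close> by (simp add: not_integrable_integral_eq)
qed

text \<open>With \<open>2 ^ k\<close> of order \<open>sqrt T / L\<close>, the resolution
  \<open>1 / 2 ^ k\<close> and the error \<open>2 ^ k * d * harm (2 ^ k)\<close> are both at most of
  order \<open>L / sqrt T\<close>. The term \<open>harm (2 ^ k) * sqrt d\<close> is responsible for
  the exponent 3/2. The last bound is the failure probability: at most of order \<open>T\<close>
  events, each of probability of order \<open>1 / T\<^sup>2\<close>.\<close>

lemma error_terms_le:
  fixes T k :: nat
  defines "L \<equiv> ln (real T)" and "d \<equiv> 64 * ln (real T) / real T"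
  assumes T: "2 \<le> T" and k: "2 * sqrt (real T) / L \<le> 2 ^ k" "2 ^ k \<le> 4 * sqrt (real T) / L"
  shows "1 / 2 ^ k + 2 * (2 * (sqrt d + d) + 64 * 2 ^ k * d * harm (2 ^ k)) \<le> 200000 * (L / sqrt (real T))"
    and "2 * (16 * harm (2 ^ k) * sqrt d) \<le> 2000 * (L * sqrt L / sqrt (real T))"
    and "8 * (2 ^ k)\<^sup>2 * exp (- (2 * L)) \<le> 2000 * (L / sqrt (real T))"
proof -
  \<comment> \<open>In terms of \<open>n = sqrt T\<close> and \<open>r = sqrt L\<close> the bounds
    become rational inequalities; for instance \<open>sqrt d = 8 * r / n\<close>.\<close>
  define n r where "n = sqrt (real T)" and "r = sqrt L"
  have "2 / 3 \<le> L"
    using ln2_ge_two_thirds T unfolding L_def by (intro order_trans[OF ln2_ge_two_thirds]) simp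
  then have L: "L = r\<^sup>2" "1 / 2 \<le> L" "1 / 2 \<le> r" "0 < r"
    unfolding r_def using real_le_rsqrt[of "1 / 2" L] by (auto simp: power2_eq_square)
  have n: "real T = n\<^sup>2" "1 \<le> n" "0 < n" using T by (auto simp: n_def)
  have pk: "2 * n \<le> 2 ^ k * r\<^sup>2" "2 ^ k * r\<^sup>2 \<le> 4 * n"
    using k L by (auto simp: n_def field_simps)
  have k8: "(2::real) ^ k \<le> 8 * n"
  proof -
    have "(2::real) ^ k * (1 / 2) \<le> 2 ^ k * r\<^sup>2" using L by (intro mult_left_mono) auto
    then show ?thesis using pk(2) by linarith
  qed
  have dn: "d = (8 * r / n)\<^sup>2" unfolding d_def L_def[symmetric] unfolding L(1) n(1) by (simp add: power2_eq_square)
  have sd: "sqrt d = 8 * r / n" unfolding dn using L n by simp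
  have H: "harm (2 ^ k) \<le> 6 * r\<^sup>2"
  proof -
    have "ln (2 ^ k) \<le> ln (8 * n)" using k8 n by simp
    also have "\<dots> = 3 * ln 2 + L / 2"
    proof -
      have "ln (8::real) = 3 * ln 2" using ln_realpow[of 2 3] by simp
      moreover have "ln n = L / 2" unfolding n_def L_def using T by (simp add: ln_sqrt)
      ultimately show ?thesis using n by (simp add: ln_mult)
    qed
    also have "ln 2 \<le> L" unfolding L_def using T by simp
    finally have "ln (2 ^ k) \<le> 4 * L" using L by simp
    moreover have "harm (2 ^ k) \<le> 1 + ln ((2::real) ^ k)" using harm_le_ln[of "2 ^ k"] by simp
    ultimately show ?thesis using L by simp
  qed
  have rr: "r \<le> 2 * r\<^sup>2" using L mult_right_mono[of "1 / 2" r r] by (simp add: power2_eq_square)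
  have a1: "1 / 2 ^ k \<le> r\<^sup>2 / n"
  proof -
    have "n \<le> 2 ^ k * r\<^sup>2" using pk n by simp
    then show ?thesis using n by (simp add: field_simps)
  qed
  have a2: "sqrt d \<le> 16 * (r\<^sup>2 / n)" unfolding sd using rr n by (simp add: field_simps)
  have a3: "d \<le> 64 * (r\<^sup>2 / n)"
  proof -
    have "r\<^sup>2 / (n * n) \<le> r\<^sup>2 / n" using n by (intro divide_left_mono) auto
    then show ?thesis unfolding dn by (simp add: power2_eq_square)
  qed
  have a4: "2 ^ k * d * harm (2 ^ k) \<le> 1536 * (r\<^sup>2 / n)"
  proof -
    have "2 ^ k * d = (2 ^ k * r\<^sup>2) * (64 / n\<^sup>2)" unfolding dn by (simp add: power2_eq_square)
    also have "\<dots> \<le> 4 * n * (64 / n\<^sup>2)" using pk by (intro mult_right_mono) auto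
    also have "\<dots> = 256 / n" using n by (simp add: power2_eq_square)
    finally have "2 ^ k * d * harm (2 ^ k) \<le> 256 / n * (6 * r\<^sup>2)"
      using H n by (intro mult_mono) (auto simp: harm_nonneg)
    then show ?thesis by simp
  qed
  have fold: "L / sqrt (real T) = r\<^sup>2 / n" "L * sqrt L / sqrt (real T) = r\<^sup>2 * r / n"
    using L by (simp_all add: n_def r_def)
  have pos: "0 \<le> r\<^sup>2 / n" using n by simp
  have comb: "a + 2 * (2 * (b + c) + 64 * e) \<le> 200000 * w"
    if "a \<le> w" "b \<le> 16 * w" "c \<le> 64 * w" "e \<le> 1536 * w" "0 \<le> w" for a b c e w :: real
    unfolding distrib_left using that by linarith
  show "1 / 2 ^ k + 2 * (2 * (sqrt d + d) + 64 * 2 ^ k * d * harm (2 ^ k)) \<le> 200000 * (L / sqrt (real T))"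
    using comb[OF a1 a2 a3 a4 pos] unfolding fold by (simp only: mult.assoc)
  have "harm (2 ^ k) * sqrt d \<le> 6 * r\<^sup>2 * (8 * r / n)"
    unfolding sd using H L n by (intro mult_right_mono) auto
  then have "2 * (16 * harm (2 ^ k) * sqrt d) \<le> 1536 * (r\<^sup>2 * r / n)" by simp
  also have "\<dots> \<le> 2000 * (r\<^sup>2 * r / n)" using L n by (intro mult_right_mono) auto
  finally show "2 * (16 * harm (2 ^ k) * sqrt d) \<le> 2000 * (L * sqrt L / sqrt (real T))" unfolding fold .
  have "exp L = n\<^sup>2" unfolding n(1)[symmetric] L_def using T by simp
  then have "exp (2 * L) = n ^ 4" by (simp only: mult_2 exp_add) (simp add: power4_eq_xxxx power2_eq_square)
  then have ex: "exp (- (2 * L)) = 1 / n ^ 4" by (simp only: exp_minus inverse_eq_divide)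
  have "((2::real) ^ k)\<^sup>2 \<le> (8 * n)\<^sup>2" using k8 by (intro power_mono) auto
  then have "8 * (2 ^ k)\<^sup>2 * exp (- (2 * L)) \<le> 8 * (8 * n)\<^sup>2 * (1 / n ^ 4)"
    unfolding ex by (intro mult_right_mono) auto
  also have "\<dots> = 512 / n * (1 / n)" using n by (simp add: power2_eq_square power4_eq_xxxx)
  also have "\<dots> \<le> 512 / n * (2 * r\<^sup>2)"
  proof (intro mult_left_mono)
    have "1 / n \<le> 1" using n by simp
    then show "1 / n \<le> 2 * r\<^sup>2" using L by linarith
  qed (use n in auto)
  also have "\<dots> = 1024 * (r\<^sup>2 / n)" by simp
  also have "\<dots> \<le> 2000 * (r\<^sup>2 / n)" using pos by (intro mult_right_mono) auto
  finally show "8 * (2 ^ k)\<^sup>2 * exp (- (2 * L)) \<le> 2000 * (L / sqrt (real T))" unfolding fold .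
qed

text \<open>Outside the exceptional set \<open>SCDL_compare\<close> is applied, for the first bound
  with the two measures in either order; on that set the integrand is at most 1 because
  \<open>SCDL\<close> lies in the unit interval.\<close>

lemma expected_SCDL_deviation:
  assumes D: "prediction_space D" and T: "2 \<le> T"
  defines "P \<equiv> PiM {..<T} (\<lambda>_. D)" and "L \<equiv> ln (real T)"
  shows "(\<integral>xs. \<bar>SCDL (empirical T xs) - SCDL D\<bar> \<partial>P) \<le> 500000 * (L * sqrt L / sqrt (real T))"
    and "SCDL D = 0 \<Longrightarrow> (\<integral>xs. SCDL (empirical T xs) \<partial>P) \<le> 500000 * (L / sqrt (real T))"
proof -
  interpret D: prediction_space D by fact
  interpret P: prob_space P unfolding P_def by (intro prob_space_PiM D.prob_space_axioms)
  have T0: "0 < T" using T by simp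
  define w where "w = L / sqrt (real T)"
  define w' where "w' = L * sqrt L / sqrt (real T)"
  \<comment> \<open>Concentration is invoked at \<open>d / 8\<close>, since
    \<open>moments_close_both\<close> costs a factor 8; the constant 64 then makes the exponent
    \<open>T * (d / 8) / 4\<close> equal to \<open>2 * L\<close>.\<close>
  define d where "d = 64 * L / real T"
  have L: "2 / 3 \<le> L"
    using T unfolding L_def by (intro order_trans[OF ln2_ge_two_thirds]) simp
  have w0: "0 \<le> w" using L by (simp add: w_def)
  \<comment> \<open>\<open>L \<ge> 2 / 3\<close> keeps \<open>sqrt L\<close> away from 0, so terms
    of order \<open>w\<close> are absorbed into \<open>w'\<close>.\<close>
  have ww: "w \<le> 2 * w'"
  proof -
    have "1 / 2 \<le> sqrt L" using L real_le_rsqrt[of "1 / 2" L] by (simp add: power2_eq_square)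
    then have "w * (1 / 2) \<le> w * sqrt L" using w0 by (intro mult_left_mono)
    then show ?thesis by (simp add: w_def w'_def)
  qed
  have d0: "0 < d" using L T0 by (simp add: d_def)
  have "1 \<le> 2 * sqrt (real T) / L"
  proof -
    have "ln (sqrt (real T)) \<le> sqrt (real T) - 1" using T0 by (intro ln_le_minus_one) simp
    then have "L \<le> 2 * sqrt (real T)" unfolding L_def using T0 by (simp add: ln_sqrt)
    then show ?thesis using L by simp
  qed
  then obtain k0 where k0: "1 \<le> k0" "2 * sqrt (real T) / L \<le> 2 ^ k0" "2 ^ k0 \<le> 2 * (2 * sqrt (real T) / L)"
    by (rule dyadic_scale)
  have k0': "2 ^ k0 \<le> 4 * sqrt (real T) / L" using k0(3) by simp
  note err = error_terms_le[OF T k0(2)[unfolded L_def] k0'[unfolded L_def],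
      folded L_def, folded d_def w_def w'_def]
  obtain Bad where Bad: "Bad \<in> sets P" "measure P Bad \<le> 8 * (2 ^ k0)\<^sup>2 * exp (- (real T * (d / 8) / 4))"
    "\<And>xs k. xs \<in> space P - Bad \<Longrightarrow> (\<And>s. s < T \<Longrightarrow> fst (xs s) \<in> {0..1}) \<Longrightarrow>
      1 \<le> k \<Longrightarrow> k \<le> k0 \<Longrightarrow>
      moments_close (8 * (d / 8)) D (empirical T xs) (2 ^ k) \<and> moments_close (8 * (d / 8)) (empirical T xs) D (2 ^ k)"
    unfolding P_def using deviation_event[OF D _ T0, of "d / 8" k0] d0 by auto
  have "real T * (d / 8) / 4 = 2 * L" using T0 by (simp add: d_def)
  then have pBad: "measure P Bad \<le> 2000 * w" using order_trans[OF Bad(2)] err(3) by simp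
  have unit: "AE xs in P. \<forall>s\<in>{..<T}. fst (xs s) \<in> {0..1}"
    unfolding P_def
    by (intro AE_finite_allI AE_PiM_component D.prob_space_axioms D.range) auto
  have close: "moments_close d D (empirical T xs) (2 ^ k)" "moments_close d (empirical T xs) D (2 ^ k)"
    if "xs \<in> space P" "xs \<notin> Bad" "\<forall>s\<in>{..<T}. fst (xs s) \<in> {0..1}" "1 \<le> k" "k \<le> k0" for xs k
    using Bad(3)[of xs k] that by auto
  have emp: "prediction_space (empirical T xs)" if "\<forall>s\<in>{..<T}. fst (xs s) \<in> {0..1}" for xs
    using that T0 by (intro prediction_space_empirical) auto
  let ?E0 = "2 * (2 * (sqrt d + d) + 64 * 2 ^ k0 * d * harm (2 ^ k0))"
  have split: "2 * (2 * (sqrt d + d) + 64 * 2 ^ k0 * d * harm (2 ^ k0) + 16 * harm (2 ^ k0) * sqrt d)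
      = ?E0 + 2 * (16 * harm (2 ^ k0) * sqrt d)" by (simp only: distrib_left)
  have "(\<integral>xs. \<bar>SCDL (empirical T xs) - SCDL D\<bar> \<partial>P) \<le> (200000 * w + 2000 * w') + measure P Bad"
  proof (rule P.integral_le_of_good_event[OF Bad(1)])
    show "0 \<le> 200000 * w + 2000 * w'" using w0 ww by simp
    show "AE xs in P. xs \<notin> Bad \<longrightarrow> \<bar>SCDL (empirical T xs) - SCDL D\<bar> \<le> 200000 * w + 2000 * w'"
      using unit AE_space
    proof eventually_elim
      case (elim xs)
      show ?case
      proof
        assume "xs \<notin> Bad"
        note c = close[OF elim(2) this elim(1)]
        have "SCDL (empirical T xs) \<le> SCDL D + 1 / 2 ^ k0 + (?E0 + 2 * (16 * harm (2 ^ k0) * sqrt d))"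
          "SCDL D \<le> SCDL (empirical T xs) + 1 / 2 ^ k0 + (?E0 + 2 * (16 * harm (2 ^ k0) * sqrt d))"
          unfolding split[symmetric] using d0 k0(1) c
          by (intro SCDL_compare(1) D emp elim; simp)+
        moreover have "\<bar>x - y\<bar> \<le> A + B" if "x \<le> y + u + (e + f)" "y \<le> x + u + (e + f)" "u + e \<le> A" "f \<le> B"
          for x y u e f A B :: real
          using that by linarith
        ultimately show "\<bar>SCDL (empirical T xs) - SCDL D\<bar> \<le> 200000 * w + 2000 * w'"
          using err(1,2) by blast
      qed
    qed
    show "AE xs in P. \<bar>SCDL (empirical T xs) - SCDL D\<bar> \<le> 1"
      using unit
    proof eventually_elim
      case (elim xs)
      interpret S: prediction_space "empirical T xs" by (rule emp[OF elim])
      show ?case using S.SCDL_nonneg S.SCDL_le_1 D.SCDL_nonneg D.SCDL_le_1 by linarith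
    qed
  qed
  then show "(\<integral>xs. \<bar>SCDL (empirical T xs) - SCDL D\<bar> \<partial>P) \<le> 500000 * (L * sqrt L / sqrt (real T))"
    using pBad ww w0 unfolding w'_def[symmetric] by linarith
  assume zero: "SCDL D = 0"
  have "(\<integral>xs. SCDL (empirical T xs) \<partial>P) \<le> 200000 * w + measure P Bad"
  proof (rule P.integral_le_of_good_event[OF Bad(1)])
    show "0 \<le> 200000 * w" using w0 by simp
    show "AE xs in P. xs \<notin> Bad \<longrightarrow> SCDL (empirical T xs) \<le> 200000 * w"
      using unit AE_space
    proof eventually_elim
      case (elim xs)
      show ?case
      proof
        assume "xs \<notin> Bad"
        note c = close[OF elim(2) this elim(1)]
        have "SCDL (empirical T xs) \<le> 1 / 2 ^ k0 + ?E0"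
          using d0 c by (intro SCDL_compare(2)[OF D emp[OF elim(1)] _ k0(1) _ zero]) auto
        then show "SCDL (empirical T xs) \<le> 200000 * w" using err(1) by (rule order_trans)
      qed
    qed
    show "AE xs in P. SCDL (empirical T xs) \<le> 1"
      using unit
    proof eventually_elim
      case (elim xs)
      show ?case using prediction_space.SCDL_le_1[OF emp[OF elim]] .
    qed
  qed
  then show "(\<integral>xs. SCDL (empirical T xs) \<partial>P) \<le> 500000 * (L / sqrt (real T))"
    using pBad w0 unfolding w_def[symmetric] by linarith
qed

theorem theorem1p6:
  "\<exists>C>0. \<forall>(D :: (real \<times> bool) measure) (T :: nat).
     prob_space D \<longrightarrow> sets D = sets (borel \<Otimes>\<^sub>M count_space UNIV) \<longrightarrow>
     (AE z in D. fst z \<in> {0..1}) \<longrightarrow> T \<ge> 2 \<longrightarrow>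
     ((\<integral>xs. \<bar>SCDL (empirical T xs) - SCDL D\<bar> \<partial>(PiM {..<T} (\<lambda>_. D)))
        \<le> C * real T powr (-1/2) * ln (real T) powr (3/2))
     \<and> (SCDL D = 0 \<longrightarrow>
        (\<integral>xs. SCDL (empirical T xs) \<partial>(PiM {..<T} (\<lambda>_. D)))
          \<le> C * real T powr (-1/2) * ln (real T))"
proof (intro exI[of _ "500000 :: real"] conjI allI impI)
  fix D :: "(real \<times> bool) measure" and T :: nat
  assume D: "prob_space D" "sets D = sets (borel \<Otimes>\<^sub>M count_space UNIV)"
    "AE z in D. fst z \<in> {0..1}" and T: "T \<ge> 2"
  have "fst \<in> borel_measurable D" "snd \<in> measurable D (count_space UNIV)"
    by (simp_all add: measurable_cong_sets[OF D(2) refl])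
  then have D': "prediction_space D"
    using D by (simp add: prediction_space_def prediction_space_axioms_def)
  have n: "real T powr (-1/2) = 1 / sqrt (real T)"
    using T by (simp add: powr_minus_divide powr_half_sqrt)
  have l: "ln (real T) powr (3/2) = ln (real T) * sqrt (ln (real T))"
    using T powr_add[of "ln (real T)" 1 "1/2"] by (simp add: powr_half_sqrt)
  show "(\<integral>xs. \<bar>SCDL (empirical T xs) - SCDL D\<bar> \<partial>(PiM {..<T} (\<lambda>_. D)))
        \<le> 500000 * real T powr (-1/2) * ln (real T) powr (3/2)"
    using expected_SCDL_deviation(1)[OF D' T] unfolding n l by simp
  show "(\<integral>xs. SCDL (empirical T xs) \<partial>(PiM {..<T} (\<lambda>_. D))) \<le> 500000 * real T powr (-1/2) * ln (real T)"
    if "SCDL D = 0"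
    using expected_SCDL_deviation(2)[OF D' T that] unfolding n by simp
qed simp

end
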